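(* Let $G$ be a complete graph with $r$ vertices, $r\ge3$, and $c\in(0,1)$. We have $$d_K\big(\widetilde N^G_n,\mathcal N\big)\lesssim\begin{cases}\dfrac{1}{n\sqrt{1-p_n}} & \text{if } c<p_n<1,\\[2mm] \dfrac{1}{n\sqrt{p_n}} & \text{if } n^{-2/(r+1)}<p_n\le c,\\[2mm] \dfrac{1}{n^{r/2}p_n^{r(r-1)/4}} & \text{if } 0<p_n\le n^{-2/(r+1)}.\end{cases}$$
   Context: For positive functions $f,g$, the notation $f\lesssim g$ means that $f\le C_G\,g$ for some constant $C_G>0$ depending only on $G$. $\mathbb G_n(p_n)$ is the Erdős–Rényi random graph obtained by independently retaining each edge of the complete graph $K_n$ on $n$ vertices with probability $p_n\in(0,1)$. $N^G_n$ is the number of (not necessarily induced) subgraphs of $\mathbb G_n(p_n)$ isomorphic to $G$, and $$\widetilde N^G_n=\frac{N^G_n-\mathbb E[N^G_n]}{\sqrt{\mathrm{Var}[N^G_n]}}.$$ $d_K(F,\mathcal N)=\sup_{x\in\mathbb R}|P(F\le x)-P(\mathcal N\le x)|$ is the Kolmogorov distance, where $\mathcal N$ is a standard normal random variable.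
   Formalization: The constant in ≲ may depend on c as well as on G (uniformity in c fails, e.g. c = p_n = 1 − n^{-2}); the bound is asserted for n ≥ r, where the normalized count is defined. *)

theory Defs
  imports "HOL-Probability.Probability"
begin

type_synonym 'a ugraph = "'a set \<times> 'a set set"

abbreviation verts :: "'a ugraph \<Rightarrow> 'a set" where "verts G \<equiv> fst G"

abbreviation edges :: "'a ugraph \<Rightarrow> 'a set set" where "edges G \<equiv> snd G"

definition all_edges :: "'a set \<Rightarrow> 'a set set" where
  "all_edges V = {e. e \<subseteq> V \<and> card e = 2}"

definition simple_graph :: "'a ugraph \<Rightarrow> bool" where
  "simple_graph G \<longleftrightarrow> finite (verts G) \<and> edges G \<subseteq> all_edges (verts G)"

definition complete_graph :: "'a ugraph \<Rightarrow> bool" where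
  "complete_graph G \<longleftrightarrow> finite (verts G) \<and> edges G = all_edges (verts G)"

definition subgraph :: "'a ugraph \<Rightarrow> 'a ugraph \<Rightarrow> bool" where
  "subgraph S H \<longleftrightarrow> simple_graph S \<and> verts S \<subseteq> verts H \<and> edges S \<subseteq> edges H"

definition graph_iso :: "'a ugraph \<Rightarrow> 'b ugraph \<Rightarrow> bool" where
  "graph_iso G H \<longleftrightarrow> (\<exists>f. bij_betw f (verts G) (verts H) \<and> (\<lambda>e. f ` e) ` edges G = edges H)"

definition subgraph_count :: "'a ugraph \<Rightarrow> 'b ugraph \<Rightarrow> nat" where
  "subgraph_count G H = card {S. subgraph S H \<and> graph_iso S G}"

(* \<open>Pi_pmf\<close> is the product distribution: the edges of K_n are kept independently.
   The value False outside the index set is irrelevant. *)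
definition erdos_renyi :: "nat \<Rightarrow> real \<Rightarrow> nat ugraph pmf" where
  "erdos_renyi n p =
     map_pmf (\<lambda>\<omega>. ({..<n}, {e \<in> all_edges {..<n}. \<omega> e}))
       (Pi_pmf (all_edges {..<n}) False (\<lambda>_. bernoulli_pmf p))"

definition standardize :: "'a pmf \<Rightarrow> ('a \<Rightarrow> real) \<Rightarrow> 'a \<Rightarrow> real" where
  "standardize M X = (\<lambda>\<omega>. (X \<omega> - measure_pmf.expectation M X) / sqrt (measure_pmf.variance M X))"

definition normalized_subgraph_count :: "'b ugraph \<Rightarrow> nat \<Rightarrow> real \<Rightarrow> nat ugraph \<Rightarrow> real" where
  "normalized_subgraph_count G n p = standardize (erdos_renyi n p) (\<lambda>H. real (subgraph_count G H))"

definition kolmogorov_dist :: "real measure \<Rightarrow> real measure \<Rightarrow> real" where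
  "kolmogorov_dist \<mu> \<nu> = (SUP x. \<bar>cdf \<mu> x - cdf \<nu> x\<bar>)"

end

theory Submission
  imports Defs "HOL-Real_Asymp.Real_Asymp"
begin

text \<open>
  Stein's method with one exchangeable pair for each clique. Write \<open>x\<^sub>S\<close> for the indicator that all \<open>k = r choose 2\<close>
  edges of the \<open>r\<close>-clique \<open>S\<close> are present, so that the count is \<open>N = \<Sum>\<^sub>S x\<^sub>S\<close>, and let primes denote the values
  after resampling the edges of \<open>S\<close>. Since \<open>x\<^sub>S - p\<^sup>k\<close> is the conditional mean of \<open>x\<^sub>S - x\<^sub>S'\<close>, the Stein
  identity for the standardised count involves the conditional means of
  \<open>\<Sum>\<^sub>S (x\<^sub>S - x\<^sub>S') (N - N')\<close> and, to control the error (as in the argument of Shao and Zhang, which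
  uses the monotonicity of \<open>w g(w)\<close> for the Stein solution \<open>g\<close>), of \<open>\<Sum>\<^sub>S \<bar>x\<^sub>S - x\<^sub>S'\<bar> (N - N')\<close>. These
  are \<open>V1 + V2\<close> and \<open>V1 - V2\<close> for two explicit polynomials with mean \<open>Var N\<close>, so the Kolmogorov
  distance is at most a constant times \<open>(sd V1 + sd V2) / Var N\<close>.

  Both variances are bounded by \<open>1 - p\<close> times a weighted sum over chains of four cliques, whereas
  \<open>Var N\<close> is at least \<open>1 - p\<close> times a weighted sum over pairs. Attaching a clique that shares an edge
  with a given bounded set costs a factor of order \<open>M = max 1 (n\<^sup>r\<^sup>-\<^sup>2 p\<^sup>k\<^sup>-\<^sup>1)\<close>, which yields the
  rate \<open>(M / ((1 - p) n\<^sup>r p\<^sup>k))\<^sup>1\<^sup>/\<^sup>2\<close> for all \<open>p\<close>.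
\<close>

section \<open>The Stein equation for the Kolmogorov distance\<close>

abbreviation std_normal_cdf :: "real \<Rightarrow> real" where
  "std_normal_cdf \<equiv> cdf std_normal_distribution"

text \<open>Near \<open>x\<close> the distribution function is a constant plus the integral of the
  continuous density from \<open>x - 1\<close>, so the fundamental theorem of calculus applies; the
  half-open interval differs from the closed one by a null set.\<close>

lemma std_normal_cdf_DERIV:
  "(std_normal_cdf has_real_derivative std_normal_density x) (at x)"
proof -
  interpret N: real_distribution std_normal_distribution by (rule real_dist_normal_dist)
  have cont: "continuous_on S std_normal_density" for S
    unfolding std_normal_density_def by (intro continuous_intros) auto
  have eq: "std_normal_cdf y = std_normal_cdf (x - 1) + integral {x-1..y} std_normal_density"
    if "y \<in> {x-1..x+1}" for y
  proof -
    have "std_normal_cdf y - std_normal_cdf (x-1) = measure std_normal_distribution {x-1<..y}"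
      using that by (cases "x - 1 = y") (auto intro!: N.cdf_diff_eq)
    also have "\<dots> = (\<integral>t. indicator {x-1<..y} t * std_normal_density t \<partial>lborel)"
      using integral_real_density[of std_normal_density lborel "indicator {x-1<..y}"]
      by (simp add: mult.commute)
    also have "\<dots> = (LINT t:{x-1<..y}|lborel. std_normal_density t)"
      by (simp add: set_lebesgue_integral_def)
    also have "\<dots> = (LINT t:{x-1..y}|lborel. std_normal_density t)"
      by (rule set_integral_cong_set)
         (auto simp: set_borel_measurable_def intro!: AE_I[where N="{x-1}"])
    also have "\<dots> = integral {x-1..y} std_normal_density"
      by (rule set_borel_integral_eq_integral) (use borel_integrable_atLeastAtMost' cont in blast)
    finally show ?thesis by simp
  qed
  have "((\<lambda>y. integral {x-1..y} std_normal_density) has_real_derivative std_normal_density x) (at x within {x-1..x+1})"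
    by (rule integral_has_real_derivative[OF cont]) auto
  hence "((\<lambda>y. std_normal_cdf (x - 1) + integral {x-1..y} std_normal_density) has_real_derivative std_normal_density x) (at x within {x-1..x+1})"
    by (auto intro!: derivative_eq_intros)
  hence "(std_normal_cdf has_real_derivative std_normal_density x) (at x within {x-1..x+1})"
    by (rule has_field_derivative_transform_within[where d=1]) (auto intro: eq[symmetric])
  thus ?thesis by (simp add: at_within_Icc_at)
qed

lemma std_normal_cdf_nonneg: "0 \<le> std_normal_cdf x"
  and std_normal_cdf_le_1: "std_normal_cdf x \<le> 1"
  and std_normal_cdf_at_top: "(std_normal_cdf \<longlongrightarrow> 1) at_top"
  and std_normal_cdf_at_bot: "(std_normal_cdf \<longlongrightarrow> 0) at_bot"
proof -
  interpret N: real_distribution std_normal_distribution by (rule real_dist_normal_dist)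
  show "0 \<le> std_normal_cdf x" "std_normal_cdf x \<le> 1" "(std_normal_cdf \<longlongrightarrow> 1) at_top"
    "(std_normal_cdf \<longlongrightarrow> 0) at_bot"
    using N.cdf_nonneg N.cdf_bounded_prob N.cdf_lim_at_top_prob N.cdf_lim_at_bot by auto
qed

lemma std_normal_density_DERIV:
  "(std_normal_density has_real_derivative - x * std_normal_density x) (at x)"
  unfolding std_normal_density_def by (auto intro!: derivative_eq_intros simp: field_simps)

lemma std_normal_density_even: "std_normal_density (- x) = std_normal_density x"
  by (simp add: std_normal_density_def)

text \<open>The sum of the values at \<open>x\<close> and \<open>- x\<close> has derivative zero
  because the density is even, and its limit at infinity identifies the constant.\<close>

lemma std_normal_cdf_uminus: "std_normal_cdf (- x) = 1 - std_normal_cdf x"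
proof -
  have "((\<lambda>x. std_normal_cdf x + std_normal_cdf (- x)) has_real_derivative 0) (at x)" for x
    by (rule derivative_eq_intros DERIV_chain2[OF std_normal_cdf_DERIV] std_normal_cdf_DERIV refl)+
       (simp add: std_normal_density_even)
  then obtain k where k: "\<And>x. std_normal_cdf x + std_normal_cdf (- x) = k"
    using DERIV_isconst_all[where f="\<lambda>x. std_normal_cdf x + std_normal_cdf (- x)"] by blast
  have "((\<lambda>x. std_normal_cdf x + std_normal_cdf (- x)) \<longlongrightarrow> 1 + 0) at_top"
    by (intro tendsto_add std_normal_cdf_at_top
        filterlim_compose[OF std_normal_cdf_at_bot filterlim_uminus_at_bot_at_top])
  hence "k = 1" by (simp add: k tendsto_const_iff)
  thus ?thesis using k[of x] by simp
qed

text \<open>\<open>f\<close> is nondecreasing up to \<open>x\<close>, so \<open>f x\<close>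
  dominates its limit at minus infinity. The tail inequalities below are checked this way, by
  differentiation.\<close>

lemma nonneg_if_DERIV_nonneg_at_bot:
  fixes f f' :: "real \<Rightarrow> real"
  assumes "\<And>y. y \<le> x \<Longrightarrow> (f has_real_derivative f' y) (at y)" "\<And>y. y \<le> x \<Longrightarrow> 0 \<le> f' y"
    and "(f \<longlongrightarrow> 0) at_bot"
  shows "0 \<le> f x"
proof -
  have "f y \<le> f x" if "y \<le> x" for y
    by (rule DERIV_nonneg_imp_nondecreasing[OF that]) (use assms in fastforce)
  hence "eventually (\<lambda>y. f y \<le> f x) at_bot"
    unfolding eventually_at_bot_linorder by blast
  thus ?thesis by (intro tendsto_le[OF _ tendsto_const assms(3)]) auto
qed

lemma std_normal_density_at_bot:
  "((\<lambda>x. x ^ n * std_normal_density x) \<longlongrightarrow> 0) at_bot" if "n \<le> 2"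
proof -
  have "n = 0 \<or> n = 1 \<or> n = 2" using that by auto
  moreover have "((\<lambda>x::real. exp (- (x\<^sup>2) / 2)) \<longlongrightarrow> 0) at_bot"
    "((\<lambda>x::real. x * exp (- (x\<^sup>2) / 2)) \<longlongrightarrow> 0) at_bot"
    "((\<lambda>x::real. x\<^sup>2 * exp (- (x\<^sup>2) / 2)) \<longlongrightarrow> 0) at_bot"
    by real_asymp+
  note this[THEN tendsto_mult_left, of "1 / sqrt (2 * pi)"]
  ultimately show ?thesis unfolding std_normal_density_def
    by (auto simp: mult_ac)
qed

lemma std_normal_cdf_le_density: "std_normal_cdf x \<le> std_normal_density x" if "x \<le> -1"
proof -
  have "0 \<le> std_normal_density x - std_normal_cdf x"
  proof (rule nonneg_if_DERIV_nonneg_at_bot[where f = "\<lambda>x. std_normal_density x - std_normal_cdf x"])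
    show "((\<lambda>x. std_normal_density x - std_normal_cdf x) has_real_derivative
        - y * std_normal_density y - std_normal_density y) (at y)" for y
      by (intro derivative_intros std_normal_cdf_DERIV std_normal_density_DERIV)
    show "0 \<le> - y * std_normal_density y - std_normal_density y" if "y \<le> x" for y
      using mult_right_mono[of 1 "-y" "std_normal_density y"] that \<open>x \<le> -1\<close> by auto
    show "((\<lambda>x. std_normal_density x - std_normal_cdf x) \<longlongrightarrow> 0) at_bot"
      using tendsto_diff[OF std_normal_density_at_bot[of 0] std_normal_cdf_at_bot] by simp
  qed
  thus ?thesis by simp
qed

lemma std_normal_cdf_power_at_bot:
  "((\<lambda>x. x ^ n * std_normal_cdf x) \<longlongrightarrow> 0) at_bot" if "n \<le> 2"
proof (rule Lim_null_comparison)
  show "\<forall>\<^sub>F x in at_bot. norm (x ^ n * std_normal_cdf x) \<le> \<bar>x ^ n * std_normal_density x\<bar>"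
    using eventually_le_at_bot[of "-1"]
    by eventually_elim
       (auto simp: abs_mult std_normal_cdf_nonneg std_normal_cdf_le_density intro!: mult_left_mono)
  show "((\<lambda>x. \<bar>x ^ n * std_normal_density x\<bar>) \<longlongrightarrow> 0) at_bot"
    using tendsto_rabs_zero[OF std_normal_density_at_bot[OF that]] .
qed

text \<open>For negative \<open>x\<close> this is the tail bound Phi(x) \<le> phi(x) / |x|. The
  density terms of the derivative cancel and leave \<open>std_normal_cdf\<close>.\<close>

lemma mills_lower: "0 \<le> x * std_normal_cdf x + std_normal_density x"
proof (rule nonneg_if_DERIV_nonneg_at_bot[where f = "\<lambda>x. x * std_normal_cdf x + std_normal_density x"])
  show "((\<lambda>x. x * std_normal_cdf x + std_normal_density x) has_real_derivative std_normal_cdf y) (at y)" for y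
    by (rule derivative_eq_intros std_normal_cdf_DERIV std_normal_density_DERIV refl)+ simp
  show "((\<lambda>x. x * std_normal_cdf x + std_normal_density x) \<longlongrightarrow> 0) at_bot"
    using tendsto_add[OF std_normal_cdf_power_at_bot[of 1] std_normal_density_at_bot[of 0]] by simp
qed (rule std_normal_cdf_nonneg)

text \<open>The derivative is twice the expression of \<open>mills_lower\<close>. The inequality is
  what makes \<open>x * mills_fun x\<close> nondecreasing.\<close>

lemma mills_upper: "0 \<le> (1 + x\<^sup>2) * std_normal_cdf x + x * std_normal_density x"
proof (rule nonneg_if_DERIV_nonneg_at_bot
    [where f = "\<lambda>x. (1 + x\<^sup>2) * std_normal_cdf x + x * std_normal_density x"])
  show "((\<lambda>x. (1 + x\<^sup>2) * std_normal_cdf x + x * std_normal_density x) has_real_derivative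
      2 * (y * std_normal_cdf y + std_normal_density y)) (at y)" for y
    by (rule derivative_eq_intros std_normal_cdf_DERIV std_normal_density_DERIV refl)+
       (simp add: algebra_simps power2_eq_square)
  show "0 \<le> 2 * (y * std_normal_cdf y + std_normal_density y)" for y
    by (intro mult_nonneg_nonneg mills_lower) auto
  show "((\<lambda>x. (1 + x\<^sup>2) * std_normal_cdf x + x * std_normal_density x) \<longlongrightarrow> 0) at_bot"
    using tendsto_add[OF tendsto_add[OF std_normal_cdf_at_bot std_normal_cdf_power_at_bot[of 2]]
        std_normal_density_at_bot[of 1]]
    by (simp add: algebra_simps)
qed

section \<open>The Mills ratio and the Stein solution\<close>

definition mills_fun :: "real \<Rightarrow> real" where
  "mills_fun x = std_normal_cdf x / std_normal_density x"

lemma std_normal_density_pos: "std_normal_density x > 0"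
  by (simp add: normal_density_pos)

text \<open>This differential equation is the Stein equation with constant right-hand side; both
  branches of the Stein solution are therefore multiples of the Mills ratio.\<close>

lemma mills_fun_DERIV:
  "(mills_fun has_real_derivative 1 + x * mills_fun x) (at x)"
  unfolding mills_fun_def
  by (rule derivative_eq_intros std_normal_cdf_DERIV std_normal_density_DERIV refl)+
     (use std_normal_density_pos[of x] in \<open>auto simp: field_simps\<close>)

lemma mills_fun_ge: "- 1 \<le> x * mills_fun x"
  using mills_lower[of x] std_normal_density_pos[of x] by (simp add: mills_fun_def field_simps)

lemma mills_fun_mult_mono:
  assumes "x \<le> y"
  shows "x * mills_fun x \<le> y * mills_fun y"
proof -
  have "((\<lambda>x. x * mills_fun x) has_real_derivative
      ((1 + x\<^sup>2) * std_normal_cdf x + x * std_normal_density x) / std_normal_density x) (at x)" for x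
    by (rule derivative_eq_intros mills_fun_DERIV refl)+
      (use std_normal_density_pos[of x] in \<open>simp add: mills_fun_def field_simps power2_eq_square\<close>)
  thus ?thesis
    using divide_nonneg_pos[OF mills_upper std_normal_density_pos]
    by (intro DERIV_nonneg_imp_nondecreasing[OF assms]) blast
qed

text \<open>The bounded solution of f'(w) - w f(w) = 1[w \<le> z] - Phi(z). The coefficients are
  chosen so that the branches agree at \<open>w = z\<close>.\<close>

definition stein_sol :: "real \<Rightarrow> real \<Rightarrow> real" where
  "stein_sol z w = (if w \<le> z then (1 - std_normal_cdf z) * mills_fun w
                    else std_normal_cdf z * mills_fun (- w))"

lemma stein_sol_eq_left:
  "w \<le> z \<Longrightarrow> stein_sol z w = (1 - std_normal_cdf z) * mills_fun w"
  by (simp add: stein_sol_def)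

lemma stein_sol_eq_right:
  "z \<le> w \<Longrightarrow> stein_sol z w = std_normal_cdf z * mills_fun (- w)"
  by (auto simp: stein_sol_def mills_fun_def std_normal_cdf_uminus std_normal_density_even)

lemma mult_stein_sol_eq_left:
  "w \<le> z \<Longrightarrow> w * stein_sol z w = (1 - std_normal_cdf z) * (w * mills_fun w)"
  by (subst stein_sol_eq_left) (assumption, rule mult.left_commute)

lemma mult_stein_sol_eq_right:
  "z \<le> w \<Longrightarrow> w * stein_sol z w = - (std_normal_cdf z * (- w * mills_fun (- w)))"
  by (subst stein_sol_eq_right) (assumption, metis minus_mult_left minus_minus mult.left_commute)

text \<open>Each branch inherits monotonicity from \<open>x * mills_fun x\<close>; on the right
  branch the reflection and the outer minus sign cancel. The two branches are glued at
  \<open>z\<close>.\<close>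

lemma mult_stein_sol_mono:
  assumes "x \<le> y"
  shows "x * stein_sol z x \<le> y * stein_sol z y"
proof -
  have left: "x * stein_sol z x \<le> y * stein_sol z y" if "x \<le> y" "y \<le> z" for x y
    unfolding mult_stein_sol_eq_left[OF that(2)] mult_stein_sol_eq_left[OF order.trans[OF that]]
    by (intro mult_left_mono mills_fun_mult_mono that) (simp add: std_normal_cdf_le_1)
  have right: "x * stein_sol z x \<le> y * stein_sol z y" if "x \<le> y" "z \<le> x" for x y
    unfolding mult_stein_sol_eq_right[OF that(2)] mult_stein_sol_eq_right[OF order.trans[OF that(2,1)]]
    by (intro le_imp_neg_le mult_left_mono mills_fun_mult_mono std_normal_cdf_nonneg)
       (use that in simp)
  consider "y \<le> z" | "z \<le> x" | "x \<le> z" "z \<le> y" using assms by linarith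
  thus ?thesis
  proof cases
    case 1
    thus ?thesis by (rule left[OF assms])
  next
    case 2
    thus ?thesis by (rule right[OF assms])
  next
    case 3
    show ?thesis by (rule order.trans[OF left[OF 3(1) order.refl] right[OF 3(2) order.refl]])
  qed
qed

text \<open>\<open>mills_fun_ge\<close> gives the lower bound on the left branch and the upper bound
  on the right one; monotonicity carries each across \<open>z\<close>.\<close>

lemma mult_stein_sol_bounds:
  "std_normal_cdf z - 1 \<le> w * stein_sol z w" "w * stein_sol z w \<le> std_normal_cdf z"
proof -
  have left: "std_normal_cdf z - 1 \<le> w * stein_sol z w" if "w \<le> z" for w
    using mult_left_mono[OF mills_fun_ge[of w], of "1 - std_normal_cdf z"]
      std_normal_cdf_le_1[of z]
    unfolding mult_stein_sol_eq_left[OF that] by simp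
  have right: "w * stein_sol z w \<le> std_normal_cdf z" if "z \<le> w" for w
    using mult_left_mono[OF mills_fun_ge[of "-w"], of "std_normal_cdf z"]
      std_normal_cdf_nonneg[of z]
    unfolding mult_stein_sol_eq_right[OF that] by simp
  show "std_normal_cdf z - 1 \<le> w * stein_sol z w"
    using left[of w] order.trans[OF left[of z] mult_stein_sol_mono[of z w z]]
    by (cases "w \<le> z") simp_all
  show "w * stein_sol z w \<le> std_normal_cdf z"
    using right[of w] order.trans[OF mult_stein_sol_mono[of w z z] right[of z]]
    by (cases "w \<le> z") simp_all
qed

text \<open>The derivative of the Stein solution as read off from the Stein equation; at the kink
  \<open>w = z\<close> it is the left derivative.\<close>

definition stein_deriv :: "real \<Rightarrow> real \<Rightarrow> real" where
  "stein_deriv z w = w * stein_sol z w + of_bool (w \<le> z) - std_normal_cdf z"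

text \<open>The bounds on \<open>w * stein_sol z w\<close> place the derivative in [0, 1] up to
  \<open>z\<close> and in [-1, 0] beyond it.\<close>

lemma abs_stein_deriv_le: "\<bar>stein_deriv z w\<bar> \<le> 1"
proof (cases "w \<le> z")
  case True
  thus ?thesis using mult_stein_sol_bounds[where w=w and z=z]
    by (auto simp: stein_deriv_def)
next
  case False
  have "w * stein_sol z w \<le> std_normal_cdf z" "std_normal_cdf z - 1 \<le> w * stein_sol z w"
    by (rule mult_stein_sol_bounds)+
  thus ?thesis using mult_stein_sol_bounds[where w=w and z=z] False
      std_normal_cdf_nonneg[of z] std_normal_cdf_le_1[of z]
    by (auto simp: stein_deriv_def)
qed

text \<open>The indicator is discontinuous at \<open>z\<close>, so the mean value theorem is applied on
  either side of \<open>z\<close> separately.\<close>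

lemma stein_sol_increment:
  assumes "v \<le> w"
  shows "(w - v) * (v * stein_sol z v + of_bool (w \<le> z) - std_normal_cdf z)
           \<le> stein_sol z w - stein_sol z v" (is "?L v w \<le> _")
    and "stein_sol z w - stein_sol z v
           \<le> (w - v) * (w * stein_sol z w + of_bool (v \<le> z) - std_normal_cdf z)" (is "_ \<le> ?R v w")
proof -
  let ?P = "std_normal_cdf z"
  let ?h = "\<lambda>w. w * stein_sol z w"
  \<comment> \<open>Here \<open>a\<close> is the constant value of the indicator on the interval, so
    that a single differentiable branch \<open>f\<close> serves on all of it.\<close>
  have *: "(w - v) * (?h v + a - ?P) \<le> stein_sol z w - stein_sol z v
     \<and> stein_sol z w - stein_sol z v \<le> (w - v) * (?h w + a - ?P)"
    if vw: "v \<le> w" and a: "(w \<le> z \<and> a = 1) \<or> (z \<le> v \<and> a = 0)" for v w a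
  proof (cases "v = w")
    case False
    hence "v < w" using vw by simp
    obtain f where f: "\<And>t. v \<le> t \<Longrightarrow> t \<le> w \<Longrightarrow> f t = stein_sol z t"
      "\<And>t. v \<le> t \<Longrightarrow> t \<le> w \<Longrightarrow> (f has_real_derivative t * f t + a - ?P) (at t)"
    proof (cases "w \<le> z \<and> a = 1")
      case True
      show ?thesis
      proof (rule that[of "\<lambda>t. (1 - ?P) * mills_fun t"])
        show "((\<lambda>t. (1 - ?P) * mills_fun t) has_real_derivative
            t * ((1 - ?P) * mills_fun t) + a - ?P) (at t)" for t
          by (rule derivative_eq_intros mills_fun_DERIV refl)+
             (use True in \<open>simp add: algebra_simps\<close>)
      qed (use True in \<open>auto simp: stein_sol_def\<close>)
    next
      case False
      hence a': "z \<le> v" "a = 0" using a by blast+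
      show ?thesis
      proof (rule that[of "\<lambda>t. ?P * mills_fun (- t)"])
        show "((\<lambda>t. ?P * mills_fun (- t)) has_real_derivative
            t * (?P * mills_fun (- t)) + a - ?P) (at t)" for t
          by (rule derivative_eq_intros DERIV_chain2[OF mills_fun_DERIV] refl)+
             (use a' in \<open>simp add: algebra_simps\<close>)
      qed (use a' in \<open>auto simp: stein_sol_eq_right\<close>)
    qed
    obtain t where t: "v < t" "t < w" "f w - f v = (w - v) * (t * f t + a - ?P)"
      using MVT2[OF \<open>v < w\<close> f(2)] by blast
    have "?h v \<le> ?h t" "?h t \<le> ?h w"
      using t by (intro mult_stein_sol_mono; simp)+
    thus ?thesis using t f(1)[of v] f(1)[of w] f(1)[of t] \<open>v < w\<close>
      by (auto intro!: mult_left_mono)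
  qed auto
  have mono: "?h x \<le> ?h y" if "x \<le> y" for x y
    using mult_stein_sol_mono[OF that] .
  have "?L v w \<le> stein_sol z w - stein_sol z v \<and> stein_sol z w - stein_sol z v \<le> ?R v w"
  proof (cases "w \<le> z \<or> z < v")
    case True
    thus ?thesis using *[OF assms, of "of_bool (w \<le> z)"] assms by auto
  next
    case False
    \<comment> \<open>The interval straddles \<open>z\<close>: the one-branch bounds on its two
      halves are weakened to common slopes by monotonicity and then added.\<close>
    hence vw: "v \<le> z" "z < w" by auto
    have 1: "(z - v) * (?h v - ?P) \<le> (z - v) * (?h v + 1 - ?P)"
      "(w - z) * (?h v - ?P) \<le> (w - z) * (?h z - ?P)"
      "(z - v) * (?h z + 1 - ?P) \<le> (z - v) * (?h w + 1 - ?P)"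
      "(w - z) * (?h w - ?P) \<le> (w - z) * (?h w + 1 - ?P)"
      using vw mono[of v z] mono[of z w] by (auto intro!: mult_left_mono)
    have 2: "?L v w = (z - v) * (?h v - ?P) + (w - z) * (?h v - ?P)"
      "?R v w = (z - v) * (?h w + 1 - ?P) + (w - z) * (?h w + 1 - ?P)"
      using vw by (auto simp: algebra_simps)
    show ?thesis using 1 *[OF vw(1), of 1] *[OF less_imp_le[OF vw(2)], of 0]
      unfolding 2 by simp
  qed
  thus "?L v w \<le> stein_sol z w - stein_sol z v" "stein_sol z w - stein_sol z v \<le> ?R v w"
    by auto
qed

text \<open>The indicator has the opposite sign to that in \<open>stein_deriv\<close>, so that both
  summands are nondecreasing in \<open>w\<close>.\<close>

definition stein_mon :: "real \<Rightarrow> real \<Rightarrow> real" where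
  "stein_mon z w = w * stein_sol z w - of_bool (w \<le> z)"

lemma abs_stein_mon_le: "\<bar>stein_mon z w\<bar> \<le> 2"
  using mult_stein_sol_bounds[where w=w and z=z] std_normal_cdf_nonneg[of z] std_normal_cdf_le_1[of z]
  by (auto simp: stein_mon_def)

text \<open>The increments of \<open>w * stein_sol z w\<close> and of the indicator bound the
  remainder from either side, and \<open>stein_mon\<close> collects both with a nonnegative sign.
  The bound is symmetric in \<open>v\<close> and \<open>w\<close>, which allows a second use of
  exchangeability.\<close>

lemma stein_sol_taylor:
  "\<bar>stein_sol z w - stein_sol z v - (w - v) * stein_deriv z w\<bar>
     \<le> (w - v) * (stein_mon z w - stein_mon z v)"
proof (cases "v \<le> w")
  case True
  have "0 \<le> (w - v) * (w * stein_sol z w - v * stein_sol z v)"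
    "0 \<le> (w - v) * (of_bool (v \<le> z) - of_bool (w \<le> z))"
    using True mult_stein_sol_mono[OF True, of z] by auto
  thus ?thesis using stein_sol_increment[OF True, of z]
    by (simp add: stein_deriv_def stein_mon_def algebra_simps)
next
  case False
  hence vw: "w \<le> v" by simp
  have "0 \<le> (v - w) * (v * stein_sol z v - w * stein_sol z w)"
    "0 \<le> (v - w) * (of_bool (w \<le> z) - of_bool (v \<le> z))"
    using vw mult_stein_sol_mono[OF vw, of z] by auto
  thus ?thesis using stein_sol_increment[OF vw, of z]
    by (simp add: stein_deriv_def stein_mon_def algebra_simps)
qed

section \<open>Random subsets and resampling\<close>

text \<open>Each element of \<open>E\<close> is kept independently with probability
  \<open>p\<close>. Expectations are finite weighted sums over \<open>Pow E\<close>, so that no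
  measure theory enters before the transfer to the random graph.\<close>

locale random_subset =
  fixes E :: "'e set" and p :: real
  assumes finite_E: "finite E" and p_pos: "0 < p" and p_lt_1: "p < 1"
begin

definition weight :: "'e set \<Rightarrow> real" where
  "weight A = p ^ card A * (1 - p) ^ card (E - A)"

definition expec :: "('e set \<Rightarrow> real) \<Rightarrow> real" where
  "expec f = (\<Sum>A\<in>Pow E. weight A * f A)"

definition vari :: "('e set \<Rightarrow> real) \<Rightarrow> real" where
  "vari f = expec (\<lambda>A. (f A - expec f)\<^sup>2)"

lemma weight_nonneg: "0 \<le> weight A"
  using p_pos p_lt_1 by (simp add: weight_def)

lemma expec_add: "expec (\<lambda>A. f A + g A) = expec f + expec g"
  by (simp add: expec_def sum.distrib distrib_left)

lemma expec_diff: "expec (\<lambda>A. f A - g A) = expec f - expec g"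
  by (simp add: expec_def sum_subtractf right_diff_distrib)

lemma expec_cmult: "expec (\<lambda>A. c * f A) = c * expec f"
  by (simp add: expec_def sum_distrib_left mult.left_commute)

lemma expec_multc: "expec (\<lambda>A. f A * c) = expec f * c"
  by (simp add: expec_def sum_distrib_right mult.assoc)

lemma expec_divide: "expec (\<lambda>A. f A / c) = expec f / c"
  using expec_multc[of f "inverse c"] by (simp add: field_class.field_divide_inverse)

lemma expec_sum: "expec (\<lambda>A. \<Sum>i\<in>I. f i A) = (\<Sum>i\<in>I. expec (f i))"
  unfolding expec_def by (subst sum.swap) (simp add: sum_distrib_left)

lemma expec_mono: "(\<And>A. A \<subseteq> E \<Longrightarrow> f A \<le> g A) \<Longrightarrow> expec f \<le> expec g"
  unfolding expec_def by (intro sum_mono mult_left_mono weight_nonneg) auto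

lemma expec_cong: "(\<And>A. A \<subseteq> E \<Longrightarrow> f A = g A) \<Longrightarrow> expec f = expec g"
  unfolding expec_def by (intro sum.cong) auto

text \<open>Setting the factor \<open>1 - p\<close> to zero on \<open>B\<close> removes exactly the
  sets that miss an element of \<open>B\<close>; the remaining sum expands a product over
  \<open>E\<close>.\<close>

lemma expec_subset:
  assumes "B \<subseteq> E"
  shows "expec (\<lambda>A. of_bool (B \<subseteq> A)) = p ^ card B"
proof -
  let ?f = "\<lambda>e. if e \<in> B then 0 else 1 - p"
  have "expec (\<lambda>A. of_bool (B \<subseteq> A)) = (\<Sum>A\<in>Pow E. prod (\<lambda>_. p) A * prod ?f (E - A))"
    unfolding expec_def
  proof (rule sum.cong)
    fix A assume A: "A \<in> Pow E"
    show "weight A * of_bool (B \<subseteq> A) = prod (\<lambda>_. p) A * prod ?f (E - A)"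
    proof (cases "B \<subseteq> A")
      case True
      hence "prod ?f (E - A) = prod (\<lambda>_. 1 - p) (E - A)"
        by (intro prod.cong) auto
      thus ?thesis using True by (simp add: weight_def)
    next
      case False
      then obtain e where "e \<in> E - A" "e \<in> B" using assms by auto
      hence "prod ?f (E - A) = 0"
        using finite_E by (intro prod_zero) auto
      thus ?thesis using False by simp
    qed
  qed simp
  also have "\<dots> = (\<Prod>e\<in>E. p + ?f e)"
    by (rule prod_add[OF finite_E, symmetric])
  also have "\<dots> = (\<Prod>e\<in>E. if e \<in> B then p else 1)"
    by (intro prod.cong) auto
  also have "\<dots> = p ^ card B"
    using finite_E assms by (simp add: prod.If_cases Int_absorb1)
  finally show ?thesis .
qed

lemma expec_const: "expec (\<lambda>_. c) = c"
  using expec_subset[of "{}"] expec_cmult[of c "\<lambda>_. 1"] by simp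

lemma expec_nonneg: "(\<And>A. A \<subseteq> E \<Longrightarrow> 0 \<le> f A) \<Longrightarrow> 0 \<le> expec f"
  using expec_mono[of "\<lambda>_. 0" f] by (simp add: expec_const)

lemma abs_expec_le: "\<bar>expec f\<bar> \<le> expec (\<lambda>A. \<bar>f A\<bar>)"
  unfolding expec_def by (rule order.trans[OF sum_abs]) (simp add: abs_mult weight_nonneg)

text \<open>The variance of the absolute deviation is nonnegative.\<close>

lemma expec_abs_deviation_le: "expec (\<lambda>A. \<bar>f A - expec f\<bar>) \<le> sqrt (vari f)"
proof (rule real_le_rsqrt)
  let ?g = "\<lambda>A. \<bar>f A - expec f\<bar>"
  let ?m = "expec ?g"
  have "0 \<le> expec (\<lambda>A. (?g A - ?m)\<^sup>2)"
    by (intro expec_nonneg) simp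
  also have "\<dots> = expec (\<lambda>A. (f A - expec f)\<^sup>2 - 2 * ?m * ?g A + ?m\<^sup>2)"
    by (intro expec_cong) (simp add: power2_diff)
  also have "\<dots> = vari f - ?m\<^sup>2"
    by (simp add: expec_add expec_diff expec_cmult expec_const vari_def power2_eq_square)
  finally show "?m\<^sup>2 \<le> vari f" by simp
qed

lemma vari_sum:
  "vari (\<lambda>A. \<Sum>i\<in>I. f i A) =
     (\<Sum>i\<in>I. \<Sum>j\<in>I. expec (\<lambda>A. f i A * f j A) - expec (f i) * expec (f j))"
proof -
  have "vari (\<lambda>A. \<Sum>i\<in>I. f i A) = expec (\<lambda>A. (\<Sum>i\<in>I. f i A - expec (f i))\<^sup>2)"
    by (simp add: vari_def expec_sum sum_subtractf)
  also have "\<dots> = (\<Sum>i\<in>I. \<Sum>j\<in>I. expec (\<lambda>A. (f i A - expec (f i)) * (f j A - expec (f j))))"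
    by (simp add: power2_eq_square sum_product expec_sum)
  also have "\<dots> = (\<Sum>i\<in>I. \<Sum>j\<in>I. expec (\<lambda>A. f i A * f j A) - expec (f i) * expec (f j))"
  proof (intro sum.cong refl)
    fix i j
    have "expec (\<lambda>A. (f i A - expec (f i)) * (f j A - expec (f j))) =
      expec (\<lambda>A. f i A * f j A - expec (f j) * f i A - expec (f i) * f j A + expec (f i) * expec (f j))"
      by (intro expec_cong) (simp add: algebra_simps)
    thus "expec (\<lambda>A. (f i A - expec (f i)) * (f j A - expec (f j))) =
      expec (\<lambda>A. f i A * f j A) - expec (f i) * expec (f j)"
      by (simp add: expec_add expec_diff expec_cmult expec_const)
  qed
  finally show ?thesis .
qed

section \<open>Resampling and exchangeability\<close>

definition resample :: "'e set \<Rightarrow> 'e set \<Rightarrow> 'e set \<Rightarrow> 'e set" where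
  "resample S A B = (A - S) \<union> (B \<inter> S)"

lemma card_resample:
  assumes "A \<subseteq> E" "B \<subseteq> E"
  shows "card (resample S A B) + card (resample S B A) = card A + card B"
proof -
  have fin: "finite A" "finite B" using assms finite_E finite_subset by auto
  have *: "card (resample S A B) = card (A - S) + card (B \<inter> S)" if "finite A" "finite B" for A B
    unfolding resample_def using that by (intro card_Un_disjoint) auto
  have **: "card A = card (A - S) + card (A \<inter> S)" if "finite A" for A
    using that by (subst card_Un_disjoint[symmetric]) (auto intro: arg_cong[where f=card])
  show ?thesis using fin *[of A B] *[of B A] **[of A] **[of B] by simp
qed

text \<open>The joint weight depends only on the sum of the two cardinalities, which swapping the
  parts inside \<open>S\<close> preserves.\<close>

lemma weight_resample:
  assumes "A \<subseteq> E" "B \<subseteq> E"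
  shows "weight (resample S A B) * weight (resample S B A) = weight A * weight B"
proof -
  have w: "weight A * weight B = p ^ (card A + card B) * (1 - p) ^ (2 * card E - (card A + card B))"
    if "A \<subseteq> E" "B \<subseteq> E" for A B
  proof -
    have "card A \<le> card E" "card B \<le> card E" using that finite_E by (auto intro: card_mono)
    hence *: "card (E - A) + card (E - B) = 2 * card E - (card A + card B)"
      using that finite_E by (simp add: card_Diff_subset finite_subset)
    have "weight A * weight B
        = (p ^ card A * p ^ card B) * ((1 - p) ^ card (E - A) * (1 - p) ^ card (E - B))"
      unfolding weight_def by (simp only: mult_ac)
    thus ?thesis unfolding power_add[symmetric] * .
  qed
  have "resample S A B \<subseteq> E" "resample S B A \<subseteq> E" using assms by (auto simp: resample_def)
  thus ?thesis using w[of A B] w[of "resample S A B" "resample S B A"] card_resample[OF assms] assms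
    by simp
qed

text \<open>Exchangeability of a random set and its resampled version: swapping \<open>A\<close> and
  \<open>B\<close> inside \<open>S\<close> is a weight-preserving involution on pairs.\<close>

lemma expec_resample_swap:
  "expec (\<lambda>A. expec (\<lambda>B. F A (resample S A B))) = expec (\<lambda>A. expec (\<lambda>B. F (resample S A B) A))"
proof -
  have E2: "expec (\<lambda>A. expec (\<lambda>B. G A B)) = (\<Sum>(A,B)\<in>Pow E \<times> Pow E. weight A * weight B * G A B)" for G
    unfolding expec_def sum_distrib_left sum.cartesian_product by (simp add: mult.assoc)
  let ?\<phi> = "\<lambda>(A, B). (resample S A B, resample S B A)"
  have inv: "resample S (resample S A B) (resample S B A) = A" for A B
    by (auto simp: resample_def)
  have sub: "resample S A B \<subseteq> E" if "A \<subseteq> E" "B \<subseteq> E" for A B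
    using that by (auto simp: resample_def)
  show ?thesis unfolding E2
  proof (rule sum.reindex_bij_witness[of _ ?\<phi> ?\<phi>], goal_cases)
    case (5 x)
    then obtain A B where x: "x = (A, B)" "A \<subseteq> E" "B \<subseteq> E" by auto
    show ?case unfolding x(1) prod.case inv using weight_resample[OF x(2,3), of S] by simp
  qed (auto simp: inv resample_def)
qed

text \<open>Exchanging the pair turns the term with \<open>h\<close> at the resampled set into minus
  the term with \<open>h A\<close>, so the difference counts the latter twice.\<close>

lemma expec_resample_antisym:
  assumes "\<And>A A'. D A' A = - D A A'"
  shows "expec (\<lambda>A. expec (\<lambda>B. D A (resample S A B) * (h A - h (resample S A B))))
    = 2 * expec (\<lambda>A. expec (\<lambda>B. D A (resample S A B)) * h A)"
proof -
  have D: "D (resample S A B) A = - D A (resample S A B)" for A B by (rule assms)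
  have "expec (\<lambda>A. expec (\<lambda>B. D A (resample S A B) * h (resample S A B)))
      = expec (\<lambda>A. expec (\<lambda>B. D (resample S A B) A * h A))"
    using expec_resample_swap[of "\<lambda>A A'. D A A' * h A'" S] by simp
  also have "\<dots> = - expec (\<lambda>A. expec (\<lambda>B. D A (resample S A B)) * h A)"
  proof -
    have "expec (\<lambda>A. expec (\<lambda>B. D (resample S A B) A * h A))
        = expec (\<lambda>A. - 1 * (expec (\<lambda>B. D A (resample S A B)) * h A))"
      unfolding expec_multc D using expec_cmult[of "- 1"] by simp
    thus ?thesis unfolding expec_cmult by simp
  qed
  finally show ?thesis by (simp add: right_diff_distrib expec_diff expec_multc)
qed

end

section \<open>Normal approximation of the number of contained sets\<close>

text \<open>In the application \<open>E\<close> is the edge set of the complete graph and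
  \<open>Fam\<close> the family of edge sets of its r-cliques.\<close>

locale subset_count = random_subset E p for E :: "'e set" and p +
  fixes Fam :: "'e set set" and k :: nat
  assumes Fam_sub: "S \<in> Fam \<Longrightarrow> S \<subseteq> E" and card_Fam: "S \<in> Fam \<Longrightarrow> card S = k"
begin

abbreviation ind :: "'e set \<Rightarrow> 'e set \<Rightarrow> real" where
  "ind S A \<equiv> of_bool (S \<subseteq> A)"

definition cnt :: "'e set \<Rightarrow> real" where
  "cnt A = (\<Sum>S\<in>Fam. ind S A)"

text \<open>The sum and the difference of \<open>V1\<close> and \<open>V2\<close> are the conditional means in
  \<open>expec_resample_cnt\<close>.\<close>

definition V1 :: "'e set \<Rightarrow> real" where
  "V1 A = (\<Sum>S\<in>Fam. \<Sum>T\<in>Fam. (1 - p ^ card (S \<inter> T)) * ind (S \<union> T) A)"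

definition V2 :: "'e set \<Rightarrow> real" where
  "V2 A = (\<Sum>S\<in>Fam. \<Sum>T\<in>Fam. p ^ k * (ind (T - S) A - ind T A))"

lemma finite_Fam: "finite Fam"
  using Fam_sub finite_E by (intro finite_subset[of Fam "Pow E"]) auto

lemma finite_mem_Fam: "S \<in> Fam \<Longrightarrow> finite S"
  using Fam_sub finite_E finite_subset by blast

lemma expec_ind: "S \<in> Fam \<Longrightarrow> expec (ind S) = p ^ k"
  by (simp add: expec_subset Fam_sub card_Fam)

lemma expec_cnt: "expec cnt = (\<Sum>S\<in>Fam. p ^ k)"
  unfolding cnt_def expec_sum by (intro sum.cong refl expec_ind)

lemma ind_mult: "ind S A * ind T A = ind (S \<union> T) A"
  by auto

lemma card_Un_Int_Fam:
  assumes "S \<in> Fam" "T \<in> Fam"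
  shows "card (S \<union> T) + card (S \<inter> T) = 2 * k"
  using card_Un_Int[OF finite_mem_Fam finite_mem_Fam, OF assms] assms by (simp add: card_Fam)

lemma card_Diff_Fam:
  assumes "S \<in> Fam" "T \<in> Fam"
  shows "card (T - S) + card (S \<inter> T) = k"
proof -
  have "card (T - S) + card (S \<inter> T) = card ((T - S) \<union> (S \<inter> T))"
    using assms finite_mem_Fam by (intro card_Un_disjoint[symmetric]) auto
  also have "(T - S) \<union> (S \<inter> T) = T" by auto
  finally show ?thesis using assms card_Fam by simp
qed

lemma expec_ind_Un:
  assumes "S \<in> Fam" "T \<in> Fam"
  shows "expec (ind (S \<union> T)) = p ^ card (S \<union> T)"
  using assms by (intro expec_subset) (simp add: Fam_sub)

lemma vari_cnt: "vari cnt = (\<Sum>S\<in>Fam. \<Sum>T\<in>Fam. p ^ card (S \<union> T) - p ^ (2 * k))"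
  unfolding cnt_def vari_sum
proof (intro sum.cong refl)
  fix S T assume *: "S \<in> Fam" "T \<in> Fam"
  show "expec (\<lambda>A. ind S A * ind T A) - expec (ind S) * expec (ind T) = p ^ card (S \<union> T) - p ^ (2 * k)"
    unfolding ind_mult expec_ind_Un[OF *] expec_ind[OF *(1)] expec_ind[OF *(2)]
    by (simp only: power_add[symmetric] mult_2)
qed

text \<open>Since \<open>card (S \<union> T) + card (S \<inter> T) = 2 * k\<close>, each summand has
  mean equal to the covariance of the two indicators.\<close>

lemma expec_V1: "expec V1 = vari cnt"
proof -
  have "(1 - p ^ card (S \<inter> T)) * expec (ind (S \<union> T)) = p ^ card (S \<union> T) - p ^ (2 * k)"
    if "S \<in> Fam" "T \<in> Fam" for S T
  proof -
    show ?thesis unfolding expec_ind_Un[OF that]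
      by (simp add: left_diff_distrib power_add[symmetric] card_Un_Int_Fam[OF that, symmetric] add.commute)
  qed
  thus ?thesis unfolding V1_def expec_sum expec_cmult vari_cnt
    by (intro sum.cong refl)
qed

lemma expec_V2: "expec V2 = vari cnt"
proof -
  have "p ^ k * (expec (ind (T - S)) - expec (ind T)) = p ^ card (S \<union> T) - p ^ (2 * k)"
    if "S \<in> Fam" "T \<in> Fam" for S T
  proof -
    have "expec (ind (T - S)) = p ^ card (T - S)"
      using that by (intro expec_subset) (use Fam_sub in blast)
    moreover have "k + card (T - S) = card (S \<union> T)"
      using card_Un_Int_Fam[OF that] card_Diff_Fam[OF that] by simp
    ultimately show ?thesis using that
      by (simp add: right_diff_distrib power_add[symmetric] expec_ind mult_2)
  qed
  thus ?thesis unfolding V2_def expec_sum expec_cmult expec_diff vari_cnt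
    by (intro sum.cong refl)
qed

lemma ind_resample:
  "ind T (resample S A B) = ind (T - S) A * ind (T \<inter> S) B"
  by (auto simp: resample_def)

text \<open>The first summand comes from \<open>S\<close> being lost by the resampling, the second
  from \<open>S\<close> being gained. The factor for \<open>S\<close> is negative in the second case
  only, so the absolute value flips just that sign.\<close>

lemma expec_resample_product:
  assumes "S \<in> Fam" "T \<in> Fam"
  shows "expec (\<lambda>B. (ind S A - ind S (resample S A B)) * (ind T A - ind T (resample S A B)))
    = (1 - p ^ card (S \<inter> T)) * ind (S \<union> T) A + p ^ k * (ind (T - S) A - ind T A)" (is "?L = _")
    and "expec (\<lambda>B. \<bar>ind S A - ind S (resample S A B)\<bar> * (ind T A - ind T (resample S A B)))
    = (1 - p ^ card (S \<inter> T)) * ind (S \<union> T) A - p ^ k * (ind (T - S) A - ind T A)" (is "?L' = _")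
proof -
  have xt: "ind S A * ind T A = ind (S \<union> T) A" and xu: "ind S A * ind (T - S) A = ind (S \<union> T) A"
    for A by auto
  have yv: "ind S B * ind (T \<inter> S) B = ind S B" for B by auto
  have S: "ind S (resample S A B) = ind S B" for B
    by (simp add: ind_resample)
  have 1: "(ind S A - ind S (resample S A B)) * (ind T A - ind T (resample S A B))
    = ind (S \<union> T) A - ind (S \<union> T) A * ind (S \<inter> T) B + (ind (T - S) A - ind T A) * ind S B" for B
  proof -
    have "(ind S A - ind S B) * (ind T A - ind (T - S) A * ind (T \<inter> S) B)
      = ind S A * ind T A - (ind S A * ind (T - S) A) * ind (T \<inter> S) B
        + (ind (T - S) A * (ind S B * ind (T \<inter> S) B) - ind T A * ind S B)"
      by (simp only: algebra_simps)
    thus ?thesis unfolding S ind_resample[of T] xt xu yv left_diff_distrib[of _ _ "ind S B"]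
      by (simp only: Int_commute)
  qed
  have 2: "\<bar>ind S A - ind S (resample S A B)\<bar> * (ind T A - ind T (resample S A B))
    = ind (S \<union> T) A - ind (S \<union> T) A * ind (S \<inter> T) B - (ind (T - S) A - ind T A) * ind S B" for B
  proof -
    \<comment> \<open>For values 0 and 1, |x - y| = x + y - 2xy; the last term is split so that the
      later rewriting is purely linear.\<close>
    have abs: "\<bar>ind S A - ind S B\<bar> = ind S A + ind S B - ind S A * ind S B - ind S A * ind S B"
      by (cases "S \<subseteq> A"; cases "S \<subseteq> B"; simp)
    have "\<bar>ind S A - ind S B\<bar> * (ind T A - ind (T - S) A * ind (T \<inter> S) B)
      = ind S A * ind T A - (ind S A * ind (T - S) A) * ind (T \<inter> S) B
        + ind S B * ind T A - ind (T - S) A * (ind S B * ind (T \<inter> S) B)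
        - ind S B * (ind S A * ind T A) + (ind S A * ind (T - S) A) * (ind S B * ind (T \<inter> S) B)
        - ind S B * (ind S A * ind T A) + (ind S A * ind (T - S) A) * (ind S B * ind (T \<inter> S) B)"
      unfolding abs by (simp only: algebra_simps)
    thus ?thesis unfolding S ind_resample[of T] xt xu yv left_diff_distrib[of _ _ "ind S B"]
      by (simp add: Int_commute mult.commute del: Un_subset_iff)
  qed
  have e: "expec (ind (S \<inter> T)) = p ^ card (S \<inter> T)"
    using assms Fam_sub by (intro expec_subset) blast
  show "?L = (1 - p ^ card (S \<inter> T)) * ind (S \<union> T) A + p ^ k * (ind (T - S) A - ind T A)"
    unfolding 1 expec_add expec_diff expec_cmult expec_const e expec_ind[OF assms(1)]
    by (simp add: algebra_simps)
  show "?L' = (1 - p ^ card (S \<inter> T)) * ind (S \<union> T) A - p ^ k * (ind (T - S) A - ind T A)"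
    unfolding 2 expec_add expec_diff expec_cmult expec_const e expec_ind[OF assms(1)]
    by (simp add: algebra_simps)
qed

lemma expec_resample_cnt:
  "(\<Sum>S\<in>Fam. expec (\<lambda>B. (ind S A - ind S (resample S A B)) * (cnt A - cnt (resample S A B))))
     = V1 A + V2 A"
  "(\<Sum>S\<in>Fam. expec (\<lambda>B. \<bar>ind S A - ind S (resample S A B)\<bar> * (cnt A - cnt (resample S A B))))
     = V1 A - V2 A"
proof -
  have c: "cnt A - cnt B = (\<Sum>T\<in>Fam. ind T A - ind T B)" for A B
    by (simp add: cnt_def sum_subtractf)
  show "(\<Sum>S\<in>Fam. expec (\<lambda>B. (ind S A - ind S (resample S A B)) * (cnt A - cnt (resample S A B))))
     = V1 A + V2 A"
    unfolding c sum_distrib_left expec_sum V1_def V2_def sum.distrib[symmetric]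
    by (intro sum.cong refl expec_resample_product)
  show "(\<Sum>S\<in>Fam. expec (\<lambda>B. \<bar>ind S A - ind S (resample S A B)\<bar> * (cnt A - cnt (resample S A B))))
     = V1 A - V2 A"
    unfolding c sum_distrib_left expec_sum V1_def V2_def sum_subtractf[symmetric]
    by (intro sum.cong refl expec_resample_product)
qed

definition std :: "'e set \<Rightarrow> real" where
  "std A = (cnt A - expec cnt) / sqrt (vari cnt)"

text \<open>Exchangeability turns the left mean into half of a sum of products of increments of
  \<open>ind S\<close> and of the Stein solution. Expanding the latter at \<open>std A\<close> gives
  the term with \<open>V1 + V2\<close>, and the remainder bound is handled by exchangeability once
  more.\<close>

lemma expec_std_mult_stein_sol:
  assumes pos: "vari cnt > 0"
  shows "\<bar>expec (\<lambda>A. std A * stein_sol z (std A))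
            - expec (\<lambda>A. stein_deriv z (std A) * (V1 A + V2 A)) / (2 * vari cnt)\<bar>
         \<le> 2 * expec (\<lambda>A. \<bar>V1 A - V2 A\<bar>) / vari cnt"
proof -
  define \<sigma> where "\<sigma> = sqrt (vari cnt)"
  have \<sigma>: "\<sigma> > 0" "\<sigma>\<^sup>2 = vari cnt" using pos by (simp_all add: \<sigma>_def)
  define R where "R S A B = resample S A B" for S A B :: "'e set"
  define g H g' where "g = (\<lambda>A. stein_sol z (std A))" and "H = (\<lambda>A. stein_mon z (std A))"
    and "g' = (\<lambda>A. stein_deriv z (std A))"
  define X where "X S A A' = ind S A - ind S A'" for S A A' :: "'e set"
  define Y where "Y S A A' = \<bar>X S A A'\<bar> * (cnt A - cnt A')" for S A A' :: "'e set"
  have std_diff: "std A - std A' = (cnt A - cnt A') / \<sigma>" for A A'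
    by (simp add: std_def \<sigma>_def diff_divide_distrib)

  have lhs: "2 * \<sigma> * expec (\<lambda>A. std A * g A)
      = (\<Sum>S\<in>Fam. expec (\<lambda>A. expec (\<lambda>B. X S A (R S A B) * (g A - g (R S A B)))))"
  proof -
    have "\<sigma> * expec (\<lambda>A. std A * g A) = expec (\<lambda>A. \<Sum>S\<in>Fam. (ind S A - p ^ k) * g A)"
      unfolding expec_cmult[symmetric] sum_distrib_right[symmetric]
      by (intro expec_cong)
         (use \<sigma> in \<open>simp add: std_def \<sigma>_def[symmetric] expec_cnt cnt_def sum_subtractf\<close>)
    also have "\<dots> = (\<Sum>S\<in>Fam. expec (\<lambda>A. expec (\<lambda>B. X S A (R S A B)) * g A))"
      unfolding expec_sum
    proof (intro sum.cong refl expec_cong)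
      fix S A assume S: "S \<in> Fam"
      have "expec (\<lambda>B. X S A (R S A B)) = expec (\<lambda>B. ind S A - ind S B)"
        unfolding X_def R_def ind_resample by simp
      also have "\<dots> = ind S A - p ^ k"
        using S by (simp add: expec_diff expec_const expec_ind)
      finally show "(ind S A - p ^ k) * g A = expec (\<lambda>B. X S A (R S A B)) * g A" by simp
    qed
    finally have "2 * \<sigma> * expec (\<lambda>A. std A * g A)
        = (\<Sum>S\<in>Fam. 2 * expec (\<lambda>A. expec (\<lambda>B. X S A (R S A B)) * g A))"
      unfolding sum_distrib_left[symmetric] by (simp only: mult.assoc)
    also have "\<dots> = (\<Sum>S\<in>Fam. expec (\<lambda>A. expec (\<lambda>B. X S A (R S A B) * (g A - g (R S A B)))))"
      unfolding R_def
      by (intro sum.cong refl expec_resample_antisym[symmetric]) (simp add: X_def)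
    finally show ?thesis .
  qed

  have main: "(\<Sum>S\<in>Fam. expec (\<lambda>A. expec (\<lambda>B. X S A (R S A B) * ((std A - std (R S A B)) * g' A))))
      = expec (\<lambda>A. g' A * (V1 A + V2 A)) / \<sigma>"
  proof -
    have "(\<Sum>S\<in>Fam. expec (\<lambda>A. expec (\<lambda>B. X S A (R S A B) * ((std A - std (R S A B)) * g' A))))
      = expec (\<lambda>A. \<Sum>S\<in>Fam. expec (\<lambda>B. (g' A / \<sigma>) * (X S A (R S A B) * (cnt A - cnt (R S A B)))))"
      unfolding expec_sum std_diff by (simp add: field_simps)
    also have "\<dots> = expec (\<lambda>A. g' A / \<sigma> * (V1 A + V2 A))"
      unfolding expec_cmult sum_distrib_left[symmetric] X_def R_def expec_resample_cnt ..
    also have "\<dots> = expec (\<lambda>A. g' A * (V1 A + V2 A)) / \<sigma>"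
      by (simp add: expec_divide[symmetric])
    finally show ?thesis .
  qed

  \<comment> \<open>\<open>Y S\<close> is again antisymmetric, as an absolute value is symmetric;
    hence the increment of \<open>H\<close> can be replaced by twice \<open>H\<close> itself, and
    only a first-order quantity remains.\<close>
  have err: "(\<Sum>S\<in>Fam. expec (\<lambda>A. expec (\<lambda>B. \<bar>X S A (R S A B)\<bar> * ((std A - std (R S A B)) * (H A - H (R S A B))))))
      = 2 * expec (\<lambda>A. (V1 A - V2 A) * H A) / \<sigma>"
  proof -
    have "(\<Sum>S\<in>Fam. expec (\<lambda>A. expec (\<lambda>B. \<bar>X S A (R S A B)\<bar> * ((std A - std (R S A B)) * (H A - H (R S A B))))))
      = (\<Sum>S\<in>Fam. expec (\<lambda>A. expec (\<lambda>B. Y S A (R S A B) * (H A - H (R S A B)))) / \<sigma>)"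
      unfolding std_diff Y_def expec_divide[symmetric] by (simp add: mult.assoc)
    also have "\<dots> = (\<Sum>S\<in>Fam. 2 * expec (\<lambda>A. expec (\<lambda>B. Y S A (R S A B)) * H A) / \<sigma>)"
      unfolding R_def
      by (intro sum.cong refl arg_cong[where f="\<lambda>x. x / \<sigma>"] expec_resample_antisym)
         (simp add: Y_def X_def abs_minus_commute minus_mult_right)
    also have "\<dots> = 2 * expec (\<lambda>A. \<Sum>S\<in>Fam. expec (\<lambda>B. Y S A (R S A B)) * H A) / \<sigma>"
      unfolding expec_sum by (simp add: sum_distrib_left sum_divide_distrib)
    also have "\<dots> = 2 * expec (\<lambda>A. (V1 A - V2 A) * H A) / \<sigma>"
      unfolding sum_distrib_right[symmetric] Y_def X_def R_def expec_resample_cnt ..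
    finally show ?thesis .
  qed

  have "\<bar>2 * \<sigma> * expec (\<lambda>A. std A * g A) - expec (\<lambda>A. g' A * (V1 A + V2 A)) / \<sigma>\<bar>
      = \<bar>\<Sum>S\<in>Fam. expec (\<lambda>A. expec (\<lambda>B. X S A (R S A B) *
            (g A - g (R S A B) - (std A - std (R S A B)) * g' A)))\<bar>"
    unfolding lhs main[symmetric] sum_subtractf[symmetric] expec_diff[symmetric]
      right_diff_distrib[symmetric] ..
  also have "\<dots> \<le> (\<Sum>S\<in>Fam. expec (\<lambda>A. expec (\<lambda>B. \<bar>X S A (R S A B)\<bar> *
       ((std A - std (R S A B)) * (H A - H (R S A B))))))"
  proof (rule order.trans[OF sum_abs], intro sum_mono order.trans[OF abs_expec_le] expec_mono)
    fix S A B
    show "\<bar>X S A (R S A B) * (g A - g (R S A B) - (std A - std (R S A B)) * g' A)\<bar>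
        \<le> \<bar>X S A (R S A B)\<bar> * ((std A - std (R S A B)) * (H A - H (R S A B)))"
      unfolding abs_mult g_def H_def g'_def by (intro mult_left_mono stein_sol_taylor) simp
  qed
  also have "\<dots> \<le> 2 * expec (\<lambda>A. \<bar>V1 A - V2 A\<bar> * 2) / \<sigma>"
    unfolding err
  proof (intro divide_right_mono mult_left_mono expec_mono)
    fix A
    have "(V1 A - V2 A) * H A \<le> \<bar>V1 A - V2 A\<bar> * \<bar>H A\<bar>"
      by (metis abs_ge_self abs_mult)
    also have "\<dots> \<le> \<bar>V1 A - V2 A\<bar> * 2"
      unfolding H_def by (intro mult_left_mono abs_stein_mon_le) simp
    finally show "(V1 A - V2 A) * H A \<le> \<bar>V1 A - V2 A\<bar> * 2" .
  qed (use \<sigma> in auto)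
  also have "\<dots> = 4 * expec (\<lambda>A. \<bar>V1 A - V2 A\<bar>) / \<sigma>"
    by (simp add: expec_multc)
  finally have "\<bar>2 * \<sigma> * expec (\<lambda>A. std A * g A) - expec (\<lambda>A. g' A * (V1 A + V2 A)) / \<sigma>\<bar> / (2 * \<sigma>)
      \<le> 4 * expec (\<lambda>A. \<bar>V1 A - V2 A\<bar>) / \<sigma> / (2 * \<sigma>)"
    using \<sigma> by (intro divide_right_mono) auto
  moreover have "\<bar>2 * \<sigma> * expec (\<lambda>A. std A * g A) - expec (\<lambda>A. g' A * (V1 A + V2 A)) / \<sigma>\<bar> / (2 * \<sigma>)
      = \<bar>expec (\<lambda>A. std A * g A) - expec (\<lambda>A. g' A * (V1 A + V2 A)) / (2 * \<sigma>\<^sup>2)\<bar>"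
  proof -
    have "expec (\<lambda>A. std A * g A) - expec (\<lambda>A. g' A * (V1 A + V2 A)) / (2 * \<sigma>\<^sup>2)
      = (2 * \<sigma> * expec (\<lambda>A. std A * g A) - expec (\<lambda>A. g' A * (V1 A + V2 A)) / \<sigma>) / (2 * \<sigma>)"
      using \<sigma>(1) by (simp add: diff_divide_distrib power2_eq_square mult.commute)
    thus ?thesis using \<sigma>(1) by (simp only: abs_divide)
  qed
  ultimately show ?thesis
    unfolding \<sigma>(2)[symmetric] g_def g'_def by (simp add: power2_eq_square)
qed

text \<open>Average the Stein equation at \<open>std A\<close>, insert the main term of the exchange
  identity, and use that \<open>V1\<close> and \<open>V2\<close> both have mean
  \<open>s\<close>.\<close>

lemma abs_cdf_diff_le:
  assumes pos: "vari cnt > 0"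
  shows "\<bar>expec (\<lambda>A. of_bool (std A \<le> z)) - std_normal_cdf z\<bar>
    \<le> 5 / 2 * (sqrt (vari V1) + sqrt (vari V2)) / vari cnt"
proof -
  define s where "s = vari cnt"
  define d1 d2 where "d1 = (\<lambda>A. \<bar>V1 A - s\<bar>)" and "d2 = (\<lambda>A. \<bar>V2 A - s\<bar>)"
  have s: "s > 0" using pos by (simp add: s_def)
  have d: "expec d1 \<le> sqrt (vari V1)" "expec d2 \<le> sqrt (vari V2)"
    using expec_abs_deviation_le[of V1] expec_abs_deviation_le[of V2]
    by (simp_all add: d1_def d2_def s_def expec_V1 expec_V2)
  let ?W = "expec (\<lambda>A. std A * stein_sol z (std A))"
  have "expec (\<lambda>A. stein_deriv z (std A))
     = ?W + expec (\<lambda>A. of_bool (std A \<le> z)) - std_normal_cdf z"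
    unfolding stein_deriv_def by (simp add: expec_diff expec_add expec_const)
  hence split: "expec (\<lambda>A. of_bool (std A \<le> z)) - std_normal_cdf z
     = expec (\<lambda>A. stein_deriv z (std A) - stein_deriv z (std A) * (V1 A + V2 A) / (2 * s))
       - (?W - expec (\<lambda>A. stein_deriv z (std A) * (V1 A + V2 A)) / (2 * s))"
    by (simp add: expec_diff expec_divide)
  have b1: "\<bar>expec (\<lambda>A. stein_deriv z (std A) - stein_deriv z (std A) * (V1 A + V2 A) / (2 * s))\<bar>
      \<le> expec (\<lambda>A. (d1 A + d2 A) / (2 * s))"
  proof (intro order.trans[OF abs_expec_le] expec_mono)
    fix A
    have "\<bar>stein_deriv z (std A) - stein_deriv z (std A) * (V1 A + V2 A) / (2 * s)\<bar>
        = \<bar>stein_deriv z (std A)\<bar> * \<bar>1 - (V1 A + V2 A) / (2 * s)\<bar>"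
      unfolding abs_mult[symmetric] by (simp add: right_diff_distrib)
    also have "\<dots> \<le> 1 * \<bar>1 - (V1 A + V2 A) / (2 * s)\<bar>"
      by (intro mult_right_mono abs_stein_deriv_le) simp
    also have "1 - (V1 A + V2 A) / (2 * s) = ((s - V1 A) + (s - V2 A)) / (2 * s)"
      using s by (simp add: field_simps)
    also have "1 * \<bar>\<dots>\<bar> \<le> (d1 A + d2 A) / (2 * s)"
    proof -
      have "\<bar>(s - V1 A) + (s - V2 A)\<bar> \<le> d1 A + d2 A"
        unfolding d1_def d2_def by linarith
      thus ?thesis using s by (simp add: divide_right_mono)
    qed
    finally show "\<bar>stein_deriv z (std A) - stein_deriv z (std A) * (V1 A + V2 A) / (2 * s)\<bar>
        \<le> (d1 A + d2 A) / (2 * s)" .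
  qed
  have "expec (\<lambda>A. \<bar>V1 A - V2 A\<bar>) \<le> expec (\<lambda>A. d1 A + d2 A)"
    by (intro expec_mono) (auto simp: d1_def d2_def)
  hence b2: "2 * expec (\<lambda>A. \<bar>V1 A - V2 A\<bar>) / s \<le> 2 * (expec d1 + expec d2) / s"
    using s by (simp add: expec_add divide_right_mono)
  have "\<bar>expec (\<lambda>A. of_bool (std A \<le> z)) - std_normal_cdf z\<bar>
      \<le> expec (\<lambda>A. (d1 A + d2 A) / (2 * s)) + 2 * (expec d1 + expec d2) / s"
    using expec_std_mult_stein_sol[OF pos, of z] b1 b2 split unfolding s_def[symmetric] by linarith
  also have "expec (\<lambda>A. (d1 A + d2 A) / (2 * s)) + 2 * (expec d1 + expec d2) / s
      = (expec d1 + expec d2) / (2 * s) + 2 * (expec d1 + expec d2) / s"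
    by (simp add: expec_add expec_divide)
  \<comment> \<open>The derivative term contributes 1/2 and the remainder 2.\<close>
  also have "\<dots> = 5 / 2 * (expec d1 + expec d2) / s"
    using s by (simp add: field_simps)
  also have "\<dots> \<le> 5 / 2 * (sqrt (vari V1) + sqrt (vari V2)) / s"
    using d s by (intro divide_right_mono mult_left_mono add_mono) auto
  finally show ?thesis by (simp add: s_def)
qed

end

section \<open>Variance bounds\<close>

lemma one_minus_power_le:
  fixes p :: real
  assumes "0 \<le> p"
  shows "1 - p ^ n \<le> real n * (1 - p)"
  using Bernoulli_inequality[of "p - 1" n] assms by (simp add: algebra_simps)

context random_subset begin

lemma power_antimono: "i \<le> j \<Longrightarrow> p ^ j \<le> p ^ i"
  using p_pos p_lt_1 by (intro power_decreasing) auto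

text \<open>Covariances vanish for disjoint sets; for overlapping ones the last factor later
  supplies a factor \<open>1 - p\<close>.\<close>

lemma cov_subset:
  assumes "U \<subseteq> E" "U' \<subseteq> E"
  shows "expec (\<lambda>A. of_bool (U \<subseteq> A) * of_bool (U' \<subseteq> A))
           - expec (\<lambda>A. of_bool (U \<subseteq> A)) * expec (\<lambda>A. of_bool (U' \<subseteq> A))
         = p ^ card (U \<union> U') * (1 - p ^ card (U \<inter> U'))"
proof -
  have "finite U" "finite U'" using assms finite_E finite_subset by auto
  hence "card U + card U' = card (U \<union> U') + card (U \<inter> U')" by (rule card_Un_Int)
  moreover have "(of_bool (U \<subseteq> A) * of_bool (U' \<subseteq> A) :: real) = of_bool (U \<union> U' \<subseteq> A)" for A
    by auto
  moreover have "expec (\<lambda>A. of_bool (U \<union> U' \<subseteq> A)) = p ^ card (U \<union> U')"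
    using assms by (intro expec_subset) auto
  ultimately show ?thesis
    using assms by (simp only: expec_subset power_add[symmetric] right_diff_distrib mult_1_right)
qed

end

context subset_count begin

section \<open>Weighted sums over pairs and chains of sets\<close>

definition link :: "'e set \<Rightarrow> 'e set set" where
  "link U = {T \<in> Fam. T \<inter> U \<noteq> {}}"

definition pairs :: "('e set \<times> 'e set) set" where
  "pairs = Sigma Fam link"

definition m2 :: real where
  "m2 = (\<Sum>(S, T)\<in>pairs. p ^ card (S \<union> T))"

text \<open>Two overlapping pairs form, up to relabelling, a chain of four sets in which each set
  after the first meets the union of the earlier ones.\<close>

definition m4 :: real where
  "m4 = (\<Sum>(S, T)\<in>pairs. \<Sum>(S', T')\<in>pairs.
           of_bool ((S \<union> T) \<inter> (S' \<union> T') \<noteq> {}) * p ^ card (S \<union> T \<union> (S' \<union> T')))"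

lemma finite_link: "finite (link U)"
  using finite_Fam by (simp add: link_def)

lemma pairs_iff: "(S, T) \<in> pairs \<longleftrightarrow> S \<in> Fam \<and> T \<in> Fam \<and> S \<inter> T \<noteq> {}"
  by (auto simp: pairs_def link_def)

lemma sum_pairs:
  assumes "\<And>S T. S \<in> Fam \<Longrightarrow> T \<in> Fam \<Longrightarrow> S \<inter> T = {} \<Longrightarrow> f S T = 0"
  shows "(\<Sum>S\<in>Fam. \<Sum>T\<in>Fam. f S T) = (\<Sum>x\<in>pairs. f (fst x) (snd x))"
proof -
  have "(\<Sum>S\<in>Fam. \<Sum>T\<in>Fam. f S T) = (\<Sum>x\<in>Fam \<times> Fam. f (fst x) (snd x))"
    by (simp add: sum.cartesian_product case_prod_unfold)
  also have "\<dots> = (\<Sum>x\<in>pairs. f (fst x) (snd x))"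
    using finite_Fam assms by (intro sum.mono_neutral_right) (auto simp: pairs_iff)
  finally show ?thesis .
qed

lemma vari_le:
  assumes V: "V = (\<lambda>A. \<Sum>x\<in>pairs. f x A)"
    and le: "\<And>S T S' T'. (S, T) \<in> pairs \<Longrightarrow> (S', T') \<in> pairs \<Longrightarrow>
        expec (\<lambda>A. f (S, T) A * f (S', T') A) - expec (f (S, T)) * expec (f (S', T'))
        \<le> b * (of_bool ((S \<union> T) \<inter> (S' \<union> T') \<noteq> {}) * p ^ card (S \<union> T \<union> (S' \<union> T')))"
  shows "vari V \<le> b * m4"
  unfolding V vari_sum m4_def sum_distrib_left
proof (intro sum_mono, clarify)
  fix S T assume x: "(S, T) \<in> pairs"
  show "(\<Sum>j\<in>pairs. expec (\<lambda>A. f (S, T) A * f j A) - expec (f (S, T)) * expec (f j))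
      \<le> b * (\<Sum>(S', T')\<in>pairs. of_bool ((S \<union> T) \<inter> (S' \<union> T') \<noteq> {}) * p ^ card (S \<union> T \<union> (S' \<union> T')))"
    unfolding sum_distrib_left
    by (intro sum_mono) (use le[OF x] in \<open>auto simp only: case_prod_unfold prod.collapse fst_conv snd_conv split: prod.splits\<close>)
qed

text \<open>The coefficients lie between 0 and 1, and the covariance factor is at most
  \<open>card (U \<inter> U') * (1 - p)\<close> with an overlap of at most \<open>2 * k\<close>
  elements.\<close>

lemma vari_V1_le: "vari V1 \<le> 2 * real k * (1 - p) * m4"
proof (rule vari_le)
  show "V1 = (\<lambda>A. \<Sum>x\<in>pairs. (1 - p ^ card (fst x \<inter> snd x)) * ind (fst x \<union> snd x) A)"
    unfolding V1_def by (intro ext sum_pairs) simp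
next
  fix S T S' T' assume "(S, T) \<in> pairs" "(S', T') \<in> pairs"
  hence mem: "S \<in> Fam" "T \<in> Fam" "S' \<in> Fam" "T' \<in> Fam" by (auto simp: pairs_iff)
  define U U' where "U = S \<union> T" and "U' = S' \<union> T'"
  have U: "U \<subseteq> E" "U' \<subseteq> E" using mem Fam_sub by (auto simp: U_def U'_def)
  define c c' where "c = 1 - p ^ card (S \<inter> T)" and "c' = 1 - p ^ card (S' \<inter> T')"
  have c: "0 \<le> c * c'" "c * c' \<le> 1"
    using p_pos p_lt_1 by (auto simp: c_def c'_def power_le_one intro!: mult_le_one)
  have "expec (\<lambda>A. (c * ind U A) * (c' * ind U' A)) - expec (\<lambda>A. c * ind U A) * expec (\<lambda>A. c' * ind U' A)
     = (c * c') * (expec (\<lambda>A. ind U A * ind U' A) - expec (ind U) * expec (ind U'))"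
  proof -
    have "expec (\<lambda>A. (c * ind U A) * (c' * ind U' A)) = c * c' * expec (\<lambda>A. ind U A * ind U' A)"
      unfolding expec_cmult[symmetric] by (simp only: mult_ac)
    thus ?thesis unfolding expec_cmult by (simp only: right_diff_distrib mult_ac)
  qed
  also have "\<dots> = (c * c') * (p ^ card (U \<union> U') * (1 - p ^ card (U \<inter> U')))"
    by (simp only: cov_subset[OF U])
  also have "\<dots> \<le> 1 * (p ^ card (U \<union> U') * (1 - p ^ card (U \<inter> U')))"
    using c p_pos p_lt_1 by (intro mult_right_mono) (auto simp: power_le_one)
  also have "\<dots> \<le> 2 * real k * (1 - p) * (of_bool (U \<inter> U' \<noteq> {}) * p ^ card (U \<union> U'))"
  proof (cases "U \<inter> U' = {}")
    case False
    have "card (U \<inter> U') \<le> card U"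
      using U finite_E by (intro card_mono) (auto intro: finite_subset)
    also have "card U \<le> 2 * k"
      using card_Un_Int_Fam[OF mem(1,2)] by (simp add: U_def)
    finally have "real (card (U \<inter> U')) * (1 - p) \<le> real (2 * k) * (1 - p)"
      using p_lt_1 by (intro mult_right_mono) auto
    hence "1 - p ^ card (U \<inter> U') \<le> real (2 * k) * (1 - p)"
      using one_minus_power_le[of p "card (U \<inter> U')"] p_pos by simp
    hence "p ^ card (U \<union> U') * (1 - p ^ card (U \<inter> U')) \<le> p ^ card (U \<union> U') * (real (2 * k) * (1 - p))"
      using p_pos by (intro mult_left_mono) auto
    thus ?thesis using False by (simp add: mult_ac)
  qed simp
  finally show "expec (\<lambda>A. ((1 - p ^ card (fst (S, T) \<inter> snd (S, T))) * ind (fst (S, T) \<union> snd (S, T)) A) *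
        ((1 - p ^ card (fst (S', T') \<inter> snd (S', T'))) * ind (fst (S', T') \<union> snd (S', T')) A))
      - expec (\<lambda>A. (1 - p ^ card (fst (S, T) \<inter> snd (S, T))) * ind (fst (S, T) \<union> snd (S, T)) A) *
        expec (\<lambda>A. (1 - p ^ card (fst (S', T') \<inter> snd (S', T'))) * ind (fst (S', T') \<union> snd (S', T')) A)
      \<le> 2 * real k * (1 - p) * (of_bool ((S \<union> T) \<inter> (S' \<union> T') \<noteq> {}) * p ^ card (S \<union> T \<union> (S' \<union> T')))"
    unfolding U_def U'_def c_def c'_def fst_conv snd_conv .
qed

lemma cov_ind_diff_disjoint:
  assumes "T \<subseteq> E" "T' \<subseteq> E" "B \<subseteq> T" "B' \<subseteq> T'" "T \<inter> T' = {}"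
  shows "expec (\<lambda>A. (ind B A - ind T A) * (ind B' A - ind T' A))
    = (expec (ind B) - expec (ind T)) * (expec (ind B') - expec (ind T'))"
proof -
  have *: "expec (\<lambda>A. ind X A * ind Y A) = expec (ind X) * expec (ind Y)"
    if "X \<subseteq> T" "Y \<subseteq> T'" for X Y
  proof -
    have "X \<subseteq> E" "Y \<subseteq> E" "X \<inter> Y = {}" using that assms by auto
    thus ?thesis using cov_subset[of X Y] by simp
  qed
  have "expec (\<lambda>A. (ind B A - ind T A) * (ind B' A - ind T' A))
     = expec (\<lambda>A. ind B A * ind B' A - ind B A * ind T' A - (ind T A * ind B' A - ind T A * ind T' A))"
    by (intro expec_cong) (simp only: algebra_simps)
  also have "\<dots> = expec (ind B) * expec (ind B') - expec (ind B) * expec (ind T')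
      - (expec (ind T) * expec (ind B') - expec (ind T) * expec (ind T'))"
    unfolding expec_diff using assms by (simp only: * order.refl)
  finally show ?thesis by (simp only: left_diff_distrib right_diff_distrib)
qed

text \<open>If \<open>T\<close> and \<open>T'\<close> are disjoint, the two differences are
  independent. Otherwise one difference is kept, as the source of the factor \<open>1 - p\<close>,
  and the other is bounded by its first indicator.\<close>

lemma vari_V2_le: "vari V2 \<le> real k * (1 - p) * m4"
proof (rule vari_le)
  show "V2 = (\<lambda>A. \<Sum>x\<in>pairs. p ^ k * (ind (snd x - fst x) A - ind (snd x) A))"
    unfolding V2_def by (intro ext sum_pairs) (simp add: Diff_triv Int_commute)
next
  fix S T S' T' assume "(S, T) \<in> pairs" "(S', T') \<in> pairs"
  hence mem: "S \<in> Fam" "T \<in> Fam" "S' \<in> Fam" "T' \<in> Fam" by (auto simp: pairs_iff)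
  define B B' where "B = T - S" and "B' = T' - S'"
  note sub = mem[THEN Fam_sub]
  have fin: "finite S" "finite T" "finite S'" "finite T'" using mem finite_mem_Fam by auto
  have BT: "B \<subseteq> T" "B' \<subseteq> T'" by (auto simp: B_def B'_def)
  let ?y = "\<lambda>A. ind B A - ind T A" and ?y' = "\<lambda>A. ind B' A - ind T' A"
  have y: "0 \<le> ?y A" "0 \<le> ?y' A" for A using BT by auto
  have "expec (\<lambda>A. (p ^ k * ?y A) * (p ^ k * ?y' A)) - expec (\<lambda>A. p ^ k * ?y A) * expec (\<lambda>A. p ^ k * ?y' A)
     = p ^ (2 * k) * (expec (\<lambda>A. ?y A * ?y' A) - expec ?y * expec ?y')"
  proof -
    have "expec (\<lambda>A. (p ^ k * ?y A) * (p ^ k * ?y' A)) = (p ^ k * p ^ k) * expec (\<lambda>A. ?y A * ?y' A)"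
      unfolding expec_cmult[symmetric] by (simp only: mult_ac)
    thus ?thesis unfolding expec_cmult mult_2 power_add by (simp only: right_diff_distrib mult_ac)
  qed
  also have "\<dots> \<le> real k * (1 - p) * (of_bool ((S \<union> T) \<inter> (S' \<union> T') \<noteq> {}) * p ^ card (S \<union> T \<union> (S' \<union> T')))"
  proof (cases "T \<inter> T' = {}")
    case True
    have "expec (\<lambda>A. ?y A * ?y' A) - expec ?y * expec ?y' = 0"
      unfolding cov_ind_diff_disjoint[OF sub(2,4) BT True] expec_diff by simp
    thus ?thesis using p_pos p_lt_1 by simp
  next
    case False
    have "expec (\<lambda>A. ?y A * ?y' A) - expec ?y * expec ?y' \<le> expec (\<lambda>A. ?y A * ?y' A)"
      using expec_nonneg[of ?y] expec_nonneg[of ?y'] y by (simp only: diff_le_eq le_add_same_cancel1 mult_nonneg_nonneg)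
    also have "\<dots> \<le> expec (\<lambda>A. ?y A * ind B' A)"
      using y by (intro expec_mono mult_left_mono) simp_all
    also have "\<dots> = expec (\<lambda>A. ind (B \<union> B') A - ind (T \<union> B') A)"
      by (simp only: left_diff_distrib ind_mult)
    also have "\<dots> = p ^ card (B \<union> B') - p ^ card (T \<union> B')"
      unfolding expec_diff using BT sub by (subst (1 2) expec_subset) auto
    also have "\<dots> \<le> p ^ card (B \<union> B') * (1 - p ^ k)"
    proof -
      have "card (T \<union> B') \<le> card (B \<union> B') + k"
      proof -
        have "card (T \<union> B') \<le> card (T \<union> (B \<union> B'))"
          using fin by (intro card_mono) (auto simp: B_def B'_def)
        also have "\<dots> \<le> card T + card (B \<union> B')" by (rule card_Un_le)
        finally show ?thesis using card_Fam[OF mem(2)] by simp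
      qed
      from power_antimono[OF this] show ?thesis by (simp add: power_add right_diff_distrib)
    qed
    also have "\<dots> \<le> p ^ card (B \<union> B') * (real k * (1 - p))"
      using p_pos by (intro mult_left_mono one_minus_power_le) auto
    finally have "p ^ (2 * k) * (expec (\<lambda>A. ?y A * ?y' A) - expec ?y * expec ?y')
        \<le> p ^ (2 * k) * (p ^ card (B \<union> B') * (real k * (1 - p)))"
      using p_pos by (intro mult_left_mono) auto
    also have "\<dots> = real k * (1 - p) * p ^ (2 * k + card (B \<union> B'))"
      by (simp only: power_add mult_ac)
    also have "\<dots> \<le> real k * (1 - p) * p ^ card (S \<union> T \<union> (S' \<union> T'))"
    proof -
      \<comment> \<open>The prefactor \<open>p ^ (2 * k)\<close> pays for the elements of
        \<open>S\<close> and \<open>S'\<close>, which are absent from \<open>B\<close> and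
        \<open>B'\<close> respectively.\<close>
      have "card (S \<union> T \<union> (S' \<union> T')) = card ((S \<union> S') \<union> (B \<union> B'))"
        by (rule arg_cong[where f=card]) (auto simp: B_def B'_def)
      also have "\<dots> \<le> (card S + card S') + card (B \<union> B')"
        by (intro order.trans[OF card_Un_le] add_mono card_Un_le order.refl)
      finally have "card (S \<union> T \<union> (S' \<union> T')) \<le> 2 * k + card (B \<union> B')"
        using mem by (simp add: card_Fam)
      from power_antimono[OF this] show ?thesis
        using p_lt_1 by (intro mult_left_mono) auto
    qed
    also have "p ^ card (S \<union> T \<union> (S' \<union> T'))
      = of_bool ((S \<union> T) \<inter> (S' \<union> T') \<noteq> {}) * p ^ card (S \<union> T \<union> (S' \<union> T'))"
    proof -
      have "(S \<union> T) \<inter> (S' \<union> T') \<noteq> {}" using False by blast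
      thus ?thesis by (simp only: of_bool_eq mult_1 simp_thms)
    qed
    finally show ?thesis .
  qed
  finally show "expec (\<lambda>A. (p ^ k * (ind (snd (S, T) - fst (S, T)) A - ind (snd (S, T)) A)) *
        (p ^ k * (ind (snd (S', T') - fst (S', T')) A - ind (snd (S', T')) A)))
      - expec (\<lambda>A. p ^ k * (ind (snd (S, T) - fst (S, T)) A - ind (snd (S, T)) A)) *
        expec (\<lambda>A. p ^ k * (ind (snd (S', T') - fst (S', T')) A - ind (snd (S', T')) A))
      \<le> real k * (1 - p) * (of_bool ((S \<union> T) \<inter> (S' \<union> T') \<noteq> {}) * p ^ card (S \<union> T \<union> (S' \<union> T')))"
    unfolding B_def B'_def fst_conv snd_conv .
qed

text \<open>Intersecting sets share at least one element, so each covariance keeps a full factor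
  \<open>1 - p\<close>.\<close>

lemma vari_cnt_ge: "(1 - p) * m2 \<le> vari cnt"
proof -
  have "(1 - p) * m2 = (\<Sum>x\<in>pairs. p ^ card (fst x \<union> snd x) * (1 - p))"
    by (simp add: m2_def sum_distrib_left case_prod_unfold mult.commute)
  also have "\<dots> \<le> (\<Sum>x\<in>pairs. p ^ card (fst x \<union> snd x) * (1 - p ^ card (fst x \<inter> snd x)))"
  proof (intro sum_mono mult_left_mono diff_left_mono)
    fix x assume "x \<in> pairs"
    hence "fst x \<in> Fam" "fst x \<inter> snd x \<noteq> {}" by (auto simp: pairs_def link_def)
    hence "1 \<le> card (fst x \<inter> snd x)"
      using finite_mem_Fam by (simp add: Suc_le_eq card_gt_0_iff)
    from power_antimono[OF this] show "p ^ card (fst x \<inter> snd x) \<le> p" by simp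
  qed (use p_pos in auto)
  also have "\<dots> = (\<Sum>S\<in>Fam. \<Sum>T\<in>Fam. p ^ card (S \<union> T) * (1 - p ^ card (S \<inter> T)))"
    by (intro sum_pairs[symmetric]) simp
  also have "\<dots> = vari cnt"
    unfolding vari_cnt
    by (intro sum.cong refl)
       (simp add: right_diff_distrib power_add[symmetric] card_Un_Int_Fam)
  finally show ?thesis .
qed

lemma card_Un_Diff: "finite U \<Longrightarrow> finite T \<Longrightarrow> card (U \<union> T) = card U + card (T - U)"
  using card_Un_disjoint[of U "T - U"] by simp

text \<open>Starting from \<open>(S, T)\<close>, one of \<open>S'\<close> and \<open>T'\<close>
  meets the union; by symmetry let it be \<open>S'\<close>, at the cost of the factor 2. Attaching
  \<open>S'\<close> and then \<open>T'\<close> costs a factor \<open>D\<close> each.\<close>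

lemma m4_le:
  assumes D: "\<And>S T S'. S \<in> Fam \<Longrightarrow> T \<in> Fam \<Longrightarrow> S' \<in> Fam \<Longrightarrow>
      (\<Sum>T'\<in>link (S \<union> T \<union> S'). p ^ card (T' - (S \<union> T \<union> S'))) \<le> D"
    and D0: "0 \<le> D"
  shows "m4 \<le> 2 * D\<^sup>2 * m2"
proof -
  have half: "(\<Sum>(S', T')\<in>pairs. of_bool (S' \<inter> U \<noteq> {}) * p ^ card (U \<union> (S' \<union> T'))) \<le> D\<^sup>2 * p ^ card U"
    if U: "U = S \<union> T" "S \<in> Fam" "T \<in> Fam" for U S T
  proof -
    have finU: "finite U" using U finite_mem_Fam by auto
    have "(\<Sum>(S', T')\<in>pairs. of_bool (S' \<inter> U \<noteq> {}) * p ^ card (U \<union> (S' \<union> T')))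
        = (\<Sum>S'\<in>Fam. of_bool (S' \<inter> U \<noteq> {}) * (\<Sum>T'\<in>link S'. p ^ card (U \<union> (S' \<union> T'))))"
      unfolding pairs_def sum_distrib_left
      by (rule sum.Sigma[symmetric]) (use finite_Fam finite_link in auto)
    also have "\<dots> = (\<Sum>S'\<in>link U. \<Sum>T'\<in>link S'. p ^ card (U \<union> (S' \<union> T')))"
      by (rule sum.mono_neutral_cong_right) (use finite_Fam in \<open>auto simp: link_def\<close>)
    also have "\<dots> \<le> (\<Sum>S'\<in>link U. p ^ card (U \<union> S') * D)"
    proof (intro sum_mono)
      fix S' assume "S' \<in> link U"
      hence S': "S' \<in> Fam" by (simp add: link_def)
      have fin: "finite (U \<union> S')" using finU finite_mem_Fam[OF S'] by simp
      \<comment> \<open>The last set need only meet \<open>S'\<close>; allowing it to meet anything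
        placed so far brings the sum into the form bounded by \<open>D\<close>.\<close>
      have "(\<Sum>T'\<in>link S'. p ^ card (U \<union> (S' \<union> T'))) \<le> (\<Sum>T'\<in>link (U \<union> S'). p ^ card (U \<union> (S' \<union> T')))"
        using p_pos finite_link by (intro sum_mono2) (auto simp: link_def)
      also have "\<dots> = (\<Sum>T'\<in>link (U \<union> S'). p ^ card (U \<union> S') * p ^ card (T' - (U \<union> S')))"
        unfolding power_add[symmetric] Un_assoc[symmetric]
        by (intro sum.cong refl arg_cong[where f="(^) p"] card_Un_Diff fin)
           (auto simp: link_def finite_mem_Fam)
      also have "\<dots> \<le> p ^ card (U \<union> S') * D"
        unfolding sum_distrib_left[symmetric] U(1)
        using p_pos by (intro mult_left_mono D U S') auto
      finally show "(\<Sum>T'\<in>link S'. p ^ card (U \<union> (S' \<union> T'))) \<le> p ^ card (U \<union> S') * D" .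
    qed
    also have "\<dots> = D * (\<Sum>S'\<in>link U. p ^ card U * p ^ card (S' - U))"
      unfolding sum_distrib_left power_add[symmetric]
      by (intro sum.cong refl) (auto simp: card_Un_Diff finU link_def finite_mem_Fam)
    also have "\<dots> \<le> D * (p ^ card U * D)"
      unfolding sum_distrib_left[symmetric]
      \<comment> \<open>Repeating \<open>T\<close> as third set yields the bound for attaching to
        two sets.\<close>
      using D[of S T T] p_pos U by (intro mult_left_mono D0) (auto simp: Un_assoc)
    finally show ?thesis by (simp add: power2_eq_square mult_ac)
  qed
  have swap: "(\<Sum>(S', T')\<in>pairs. of_bool (T' \<inter> U \<noteq> {}) * p ^ card (U \<union> (S' \<union> T')))
      = (\<Sum>(S', T')\<in>pairs. of_bool (S' \<inter> U \<noteq> {}) * p ^ card (U \<union> (S' \<union> T')))" for U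
    by (rule sum.reindex_bij_witness[of _ prod.swap prod.swap])
       (auto simp: pairs_iff Un_commute Int_commute)
  have "(\<Sum>(S', T')\<in>pairs. of_bool (U \<inter> (S' \<union> T') \<noteq> {}) * p ^ card (U \<union> (S' \<union> T'))) \<le> 2 * D\<^sup>2 * p ^ card U"
    if U: "U = S \<union> T" "S \<in> Fam" "T \<in> Fam" for U S T
  proof -
    have "(\<Sum>(S', T')\<in>pairs. of_bool (U \<inter> (S' \<union> T') \<noteq> {}) * p ^ card (U \<union> (S' \<union> T')))
       \<le> (\<Sum>(S', T')\<in>pairs. of_bool (S' \<inter> U \<noteq> {}) * p ^ card (U \<union> (S' \<union> T'))
           + of_bool (T' \<inter> U \<noteq> {}) * p ^ card (U \<union> (S' \<union> T')))"
      using p_pos by (intro sum_mono) (auto simp: Int_Un_distrib Int_commute)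
    also have "\<dots> = 2 * (\<Sum>(S', T')\<in>pairs. of_bool (S' \<inter> U \<noteq> {}) * p ^ card (U \<union> (S' \<union> T')))"
      using swap[of U] by (simp add: case_prod_unfold sum.distrib)
    finally show ?thesis using half[OF U] by simp
  qed
  hence "m4 \<le> (\<Sum>(S, T)\<in>pairs. 2 * D\<^sup>2 * p ^ card (S \<union> T))"
    unfolding m4_def by (intro sum_mono) (auto simp: pairs_iff simp del: Un_assoc)
  thus ?thesis by (simp add: m2_def sum_distrib_left case_prod_unfold)
qed

text \<open>Both variances are at most \<open>Q\<close>, of order
  \<open>(1 - p) * D\<^sup>2 * m2\<close>, while the variance of the count is at least
  \<open>(1 - p) * m2\<close>; the quotient of standard deviation and variance leaves
  \<open>D / sqrt ((1 - p) * m2)\<close> up to a constant.\<close>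

lemma abs_cdf_diff_le_m2:
  assumes D: "\<And>S T S'. S \<in> Fam \<Longrightarrow> T \<in> Fam \<Longrightarrow> S' \<in> Fam \<Longrightarrow>
      (\<Sum>T'\<in>link (S \<union> T \<union> S'). p ^ card (T' - (S \<union> T \<union> S'))) \<le> D"
    and D0: "0 \<le> D" and m2_pos: "0 < m2"
  shows "\<bar>expec (\<lambda>A. of_bool (std A \<le> z)) - std_normal_cdf z\<bar> \<le> 10 * D * sqrt (real k / ((1 - p) * m2))"
proof -
  define q where "q = 1 - p"
  have q: "q > 0" using p_lt_1 by (simp add: q_def)
  have var_pos: "0 < q * m2" "q * m2 \<le> vari cnt"
    using q m2_pos vari_cnt_ge by (simp_all add: q_def)
  define Q where "Q = 4 * real k * q * D\<^sup>2 * m2"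
  have m4: "2 * real k * q * m4 \<le> Q"
    using mult_left_mono[OF m4_le[OF D D0], of "2 * real k * q"] q by (simp add: Q_def mult_ac)
  have m4_nonneg: "0 \<le> m4"
    unfolding m4_def using p_pos by (intro sum_nonneg) (auto intro!: sum_nonneg)
  hence "0 \<le> real k * q * m4" using q by simp
  hence "vari V1 \<le> Q" "vari V2 \<le> Q"
    using vari_V1_le vari_V2_le m4 unfolding q_def by linarith+
  hence "sqrt (vari V1) + sqrt (vari V2) \<le> 2 * sqrt Q"
    using add_mono[of "sqrt (vari V1)" "sqrt Q" "sqrt (vari V2)" "sqrt Q"] by simp
  hence "5 / 2 * (sqrt (vari V1) + sqrt (vari V2)) / vari cnt \<le> 5 * sqrt Q / (q * m2)"
    using var_pos m4 \<open>0 \<le> real k * q * m4\<close> by (intro frac_le) auto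
  also have "sqrt Q = sqrt ((2 * D * (q * m2))\<^sup>2 * (real k / (q * m2)))"
    using q m2_pos by (intro arg_cong[where f=sqrt]) (simp add: Q_def field_simps power2_eq_square)
  also have "\<dots> = 2 * D * (q * m2) * sqrt (real k / (q * m2))"
    using q m2_pos D0 by (simp only: real_sqrt_mult real_sqrt_abs) simp
  also have "5 * \<dots> / (q * m2) = 10 * D * sqrt (real k / (q * m2))"
    using q m2_pos by simp
  finally show ?thesis
    using abs_cdf_diff_le[of z] var_pos by (simp add: q_def)
qed

end

section \<open>Cliques\<close>

lemma card_all_edges: "finite V \<Longrightarrow> card (all_edges V) = card V choose 2"
  by (simp add: all_edges_def n_subsets)

lemma all_edges_mono: "V \<subseteq> W \<Longrightarrow> all_edges V \<subseteq> all_edges W"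
  by (auto simp: all_edges_def)

lemma finite_all_edges: "finite V \<Longrightarrow> finite (all_edges V)"
  by (rule finite_subset[of _ "Pow V"]) (auto simp: all_edges_def)

text \<open>Every vertex lies on an edge, so the vertex set is recovered from the edge set; this
  makes \<open>all_edges\<close> injective on such sets.\<close>

lemma Union_all_edges:
  assumes "2 \<le> card V"
  shows "\<Union> (all_edges V) = V"
proof
  show "V \<subseteq> \<Union> (all_edges V)"
  proof
    fix x assume x: "x \<in> V"
    have "finite V" using assms by (metis card.infinite not_numeral_le_zero)
    hence "1 \<le> card (V - {x})" using assms x by simp
    then obtain y where "y \<in> V - {x}" by (metis card.empty ex_in_conv not_one_le_zero)
    hence "{x, y} \<in> all_edges V" using x by (auto simp: all_edges_def card_2_iff)
    thus "x \<in> \<Union> (all_edges V)" by blast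
  qed
qed (auto simp: all_edges_def)

lemma inj_on_all_edges: "inj_on all_edges {V. 2 \<le> card V}"
  by (rule inj_on_inverseI[where g=Union]) (simp add: Union_all_edges)

lemma choose_2_eq_sum: "j \<le> r \<Longrightarrow> (\<Sum>i=j..<r. i) + (j choose 2) = r choose 2"
  by (induction r rule: dec_induct) (auto simp: numeral_2_eq_2)

text \<open>The second entry is, up to a constant, the expected number of cliques through an edge
  known to be present; the entry 1 accounts for cliques without new vertices.\<close>

definition clique_density :: "nat \<Rightarrow> nat \<Rightarrow> real \<Rightarrow> real" where
  "clique_density r n p = max 1 (real n ^ (r - 2) * p ^ ((r choose 2) - 1))"

text \<open>The factors \<open>n p^i\<close> of the left-hand side decrease in \<open>i\<close>, so omitting the initial ones
  is harmful only once all remaining factors are at most one.\<close>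

lemma extension_weight_le:
  assumes p: "0 < p" "p < 1" and j: "2 \<le> j" "j \<le> r"
  shows "real n ^ (r - j) * p ^ ((r choose 2) - (j choose 2)) \<le> clique_density r n p"
proof -
  define b where "b i = real n * p ^ i" for i
  have b0: "0 \<le> b i" for i using p by (simp add: b_def)
  have eq: "real n ^ (r - j) * p ^ ((r choose 2) - (j choose 2)) = prod b {j..<r}" if "j \<le> r" for j
  proof -
    have "(r choose 2) - (j choose 2) = (\<Sum>i=j..<r. i)"
      using choose_2_eq_sum[OF that] by linarith
    moreover have "prod b {j..<r} = (\<Prod>i=j..<r. real n * p ^ i)"
      by (simp add: b_def)
    ultimately show ?thesis by (simp add: prod.distrib power_sum)
  qed
  have mono: "b i \<le> b j" if "j \<le> i" for i j
    using p that unfolding b_def by (intro mult_left_mono power_decreasing) auto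
  have "prod b {j..<r} \<le> max 1 (prod b {2..<r})"
  proof (cases "b j \<le> 1")
    case True
    have "prod b {j..<r} \<le> 1"
      using b0 mono[of j] True by (intro prod_le_1) (auto intro: order.trans)
    thus ?thesis by simp
  next
    case False
    have "1 \<le> prod b {2..<j}"
      using mono[of _ j] False by (intro prod_ge_1) (meson atLeastLessThan_iff less_imp_le linorder_not_less order.trans)
    hence "1 * prod b {j..<r} \<le> prod b {2..<j} * prod b {j..<r}"
      using b0 by (intro mult_right_mono prod_nonneg) auto
    also have "\<dots> = prod b {2..<r}"
      using j by (rule prod.atLeastLessThan_concat)
    finally show ?thesis by simp
  qed
  also have "prod b {2..<r} = real n ^ (r - 2) * p ^ ((r choose 2) - 1)"
    using eq[of 2] j by simp
  finally show ?thesis using eq[OF j(2)] by (simp add: clique_density_def)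
qed

lemma binomial_diff_2_ge:
  assumes "3 \<le> r" "r \<le> n"
  shows "(real n / real r) ^ (r - 2) \<le> real ((n - 2) choose (r - 2))"
proof -
  have "real n / real r \<le> real (n - 2) / real (r - 2)"
    using assms by (simp add: field_simps of_nat_diff)
  hence "(real n / real r) ^ (r - 2) \<le> (real (n - 2) / real (r - 2)) ^ (r - 2)"
    by (intro power_mono) auto
  also have "\<dots> \<le> real ((n - 2) choose (r - 2))"
    using assms by (intro binomial_ge_n_over_k_pow_k) auto
  finally show ?thesis .
qed

section \<open>Counting cliques attached to a vertex set\<close>

locale clique_count =
  fixes n r :: nat and p :: real
  assumes r_ge_3: "3 \<le> r" and r_le_n: "r \<le> n" and p01: "0 < p" "p < 1"
begin

abbreviation "V \<equiv> {..<n}"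
abbreviation "k \<equiv> r choose 2"
abbreviation "M \<equiv> clique_density r n p"

definition cliques :: "nat set set set" where
  "cliques = all_edges ` {S. S \<subseteq> V \<and> card S = r}"

lemma inj_cliques: "inj_on all_edges {S. S \<subseteq> V \<and> card S = r \<and> P S}"
  by (rule inj_on_subset[OF inj_on_all_edges]) (use r_ge_3 in auto)

lemma inj_cliques': "inj_on all_edges {S. S \<subseteq> V \<and> card S = r}"
  using inj_cliques[of "\<lambda>_. True"] by simp

lemma finite_sub_V: "S \<subseteq> V \<Longrightarrow> finite S"
  by (rule finite_subset) auto

sublocale C: subset_count "all_edges V" p cliques k
proof
  show "finite (all_edges V)" by (simp add: finite_all_edges)
  show "0 < p" "p < 1" by (fact p01)+
  fix S assume "S \<in> cliques"
  thus "S \<subseteq> all_edges V" "card S = k"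
    by (auto simp: cliques_def card_all_edges finite_sub_V dest: all_edges_mono)
qed

lemma M_ge_1: "1 \<le> M"
  by (simp add: clique_density_def)

text \<open>Sort the cliques by their trace on \<open>V0\<close>, of size j say. It has at least two
  vertices since an edge is shared, at least \<open>k - (j choose 2)\<close> edges are new, and
  there are at most \<open>n ^ (r - j)\<close> completions. Each of the at most
  \<open>2 ^ card V0\<close> traces thus contributes at most \<open>M\<close>.\<close>

lemma sum_link_le:
  assumes V0: "V0 \<subseteq> V" and U: "U \<subseteq> all_edges V0"
  shows "(\<Sum>T\<in>C.link U. p ^ card (T - U)) \<le> 2 ^ card V0 * M"
proof -
  define h where "h j = p ^ (k - (j choose 2))" for j
  let ?I = "{S. S \<subseteq> V \<and> card S = r \<and> all_edges S \<inter> U \<noteq> {}}"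
  \<comment> \<open>Pairs of a trace and a set of remaining vertices. The latter ranges over all of
    \<open>V\<close> instead of avoiding \<open>V0\<close>, an overcount that is harmless for an
    upper bound.\<close>
  let ?J = "SIGMA J:{J\<in>Pow V0. 2 \<le> card J \<and> card J \<le> r}. {R. R \<subseteq> V \<and> card R = r - card J}"
  have finV0: "finite V0" using V0 by (rule finite_sub_V)
  have link: "C.link U = all_edges ` ?I"
    unfolding C.link_def by (auto simp: cliques_def)
  have "(\<Sum>T\<in>C.link U. p ^ card (T - U)) = (\<Sum>S\<in>?I. p ^ card (all_edges S - U))"
    unfolding link by (rule sum.reindex_cong[OF inj_cliques]) auto
  also have "\<dots> \<le> (\<Sum>S\<in>?I. h (card (S \<inter> V0)))"
  proof (intro sum_mono)
    fix S assume S: "S \<in> ?I"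
    hence finS: "finite S" by (intro finite_sub_V) simp
    have "all_edges S - all_edges (S \<inter> V0) \<subseteq> all_edges S - U"
      using U by (auto simp: all_edges_def)
    hence "card (all_edges S - all_edges (S \<inter> V0)) \<le> card (all_edges S - U)"
      using finite_all_edges[OF finS] by (intro card_mono) auto
    moreover have "card (all_edges S - all_edges (S \<inter> V0)) = k - (card (S \<inter> V0) choose 2)"
      using finS S by (subst card_Diff_subset) (auto simp: finite_all_edges all_edges_mono card_all_edges)
    ultimately show "p ^ card (all_edges S - U) \<le> h (card (S \<inter> V0))"
      unfolding h_def by (intro C.power_antimono) simp
  qed
  also have "\<dots> = (\<Sum>x\<in>(\<lambda>S. (S \<inter> V0, S - V0)) ` ?I. h (card (fst x)))"
    by (subst sum.reindex) (auto intro!: inj_onI)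
  also have "\<dots> \<le> (\<Sum>x\<in>?J. h (card (fst x)))"
  proof (intro sum_mono2)
    show "finite ?J" using finV0 by auto
    show "(\<lambda>S. (S \<inter> V0, S - V0)) ` ?I \<subseteq> ?J"
    proof (rule image_subsetI)
      fix S assume "S \<in> ?I"
      then obtain e where S: "S \<subseteq> V" "card S = r" and e: "e \<in> all_edges S" "e \<in> U" by auto
      have finS: "finite S" using S(1) by (rule finite_sub_V)
      have "e \<subseteq> S \<inter> V0" "card e = 2" using e U by (auto simp: all_edges_def)
      hence "2 \<le> card (S \<inter> V0)" using finS card_mono[of "S \<inter> V0" e] by simp
      moreover have "card (S \<inter> V0) \<le> card S" using finS by (intro card_mono) auto
      moreover have "card (S - V0) = card S - card (S \<inter> V0)"
        using finS by (rule card_Diff_subset_Int[OF finite_Int, OF disjI1])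
      ultimately show "(S \<inter> V0, S - V0) \<in> ?J"
        using S by auto
    qed
    show "0 \<le> h (card (fst x))" for x using p01 by (simp add: h_def)
  qed
  also have "\<dots> = (\<Sum>J\<in>{J\<in>Pow V0. 2 \<le> card J \<and> card J \<le> r}.
      \<Sum>R\<in>{R. R \<subseteq> V \<and> card R = r - card J}. h (card J))"
    by (subst sum.Sigma) (use finV0 in \<open>auto simp: case_prod_unfold\<close>)
  also have "\<dots> \<le> (\<Sum>J\<in>{J\<in>Pow V0. 2 \<le> card J \<and> card J \<le> r}. M)"
  proof (intro sum_mono)
    fix J assume J: "J \<in> {J\<in>Pow V0. 2 \<le> card J \<and> card J \<le> r}"
    have "(\<Sum>R\<in>{R. R \<subseteq> V \<and> card R = r - card J}. h (card J)) = real (n choose (r - card J)) * h (card J)"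
      using n_subsets[of V "r - card J"] by simp
    also have "\<dots> \<le> real n ^ (r - card J) * h (card J)"
    proof -
      have "n choose (r - card J) \<le> n ^ (r - card J)"
        using r_le_n by (intro binomial_le_pow) auto
      hence "real (n choose (r - card J)) \<le> real n ^ (r - card J)"
        by (metis of_nat_le_iff of_nat_power)
      thus ?thesis using p01 by (intro mult_right_mono) (auto simp: h_def)
    qed
    also have "\<dots> \<le> M"
      unfolding h_def using J p01 by (intro extension_weight_le) auto
    finally show "(\<Sum>R\<in>{R. R \<subseteq> V \<and> card R = r - card J}. h (card J)) \<le> M" .
  qed
  also have "\<dots> \<le> 2 ^ card V0 * M"
  proof -
    have "card {J\<in>Pow V0. 2 \<le> card J \<and> card J \<le> r} \<le> 2 ^ card V0"
      using finV0 by (subst card_Pow[symmetric]) (auto intro!: card_mono)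
    hence "real (card {J\<in>Pow V0. 2 \<le> card J \<and> card J \<le> r}) \<le> 2 ^ card V0"
      by (metis of_nat_le_iff of_nat_power of_nat_numeral)
    thus ?thesis using M_ge_1 by (simp add: mult_right_mono)
  qed
  finally show ?thesis .
qed

lemma sum_link_three_le:
  assumes "S \<in> cliques" "T \<in> cliques" "S' \<in> cliques"
  shows "(\<Sum>T'\<in>C.link (S \<union> T \<union> S'). p ^ card (T' - (S \<union> T \<union> S'))) \<le> 2 ^ (3 * r) * M"
proof -
  obtain s t s' where st: "S = all_edges s" "T = all_edges t" "S' = all_edges s'"
    "s \<subseteq> V" "t \<subseteq> V" "s' \<subseteq> V" "card s = r" "card t = r" "card s' = r"
    using assms by (auto simp: cliques_def)
  have "(\<Sum>T'\<in>C.link (S \<union> T \<union> S'). p ^ card (T' - (S \<union> T \<union> S'))) \<le> 2 ^ card (s \<union> t \<union> s') * M"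
    using st by (intro sum_link_le) (auto simp: all_edges_def)
  also have "card (s \<union> t \<union> s') \<le> 3 * r"
    using card_Un_le[of "s \<union> t" s'] card_Un_le[of s t] st by simp
  hence "(2::real) ^ card (s \<union> t \<union> s') * M \<le> 2 ^ (3 * r) * M"
    using M_ge_1 by (intro mult_right_mono power_increasing) auto
  finally show ?thesis .
qed

text \<open>It suffices to reach each entry of the maximum in \<open>M\<close>: the term
  \<open>T = S\<close> gives the entry 1, and the cliques through one fixed edge \<open>e\<close> of
  \<open>S\<close> give the other.\<close>

lemma sum_link_clique_ge:
  assumes S: "S \<in> cliques"
  shows "p ^ k * M / real r ^ (r - 2) \<le> (\<Sum>T\<in>C.link S. p ^ card (S \<union> T))" (is "_ \<le> ?rhs")
proof -
  obtain s where s: "S = all_edges s" "s \<subseteq> V" "card s = r"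
    using S by (auto simp: cliques_def)
  have k1: "1 \<le> k" using r_ge_3 by (simp add: Suc_le_eq)
  have "2 \<le> card s" using s r_ge_3 by simp
  then obtain e where e: "e \<subseteq> s" "card e = 2" using obtain_subset_with_card_n by metis
  have fin_e: "finite e" "e \<subseteq> V" using e s finite_sub_V by auto
  let ?I = "{R. R \<subseteq> V - e \<and> card R = r - 2}"
  have cardR: "card (e \<union> R) = r" if "R \<in> ?I" for R
  proof -
    have "finite R" using that by (intro finite_sub_V) auto
    hence "card (e \<union> R) = card e + card R"
      using that fin_e by (intro card_Un_disjoint) auto
    thus ?thesis using that e r_ge_3 by simp
  qed
  have inj: "inj_on (\<lambda>R. all_edges (e \<union> R)) ?I"
  proof (rule inj_onI)
    fix R R' assume R: "R \<in> ?I" "R' \<in> ?I" "all_edges (e \<union> R) = all_edges (e \<union> R')"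
    hence "e \<union> R = e \<union> R'"
      using inj_onD[OF inj_on_all_edges R(3)] cardR r_ge_3 by simp
    thus "R = R'" using R by blast
  qed
  have eS: "e \<in> S" using e s by (auto simp: all_edges_def)
  have sub: "(\<lambda>R. all_edges (e \<union> R)) ` ?I \<subseteq> C.link S"
  proof clarify
    fix R assume R: "R \<subseteq> V - e" "card R = r - 2"
    have "e \<in> all_edges (e \<union> R)" using e by (auto simp: all_edges_def)
    moreover have "all_edges (e \<union> R) \<in> cliques"
      using R cardR[of R] fin_e unfolding cliques_def by (intro imageI) auto
    ultimately show "all_edges (e \<union> R) \<in> C.link S" using eS by (auto simp: C.link_def)
  qed
  have one: "p ^ k \<le> ?rhs"
  proof -
    have "S \<in> C.link S" using S eS by (auto simp: C.link_def)
    hence "(\<Sum>T\<in>{S}. p ^ card (S \<union> T)) \<le> ?rhs"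
      using p01 C.finite_link by (intro sum_mono2) auto
    thus ?thesis using C.card_Fam[OF S] by simp
  qed
  have two: "p ^ k * ((real n / real r) ^ (r - 2) * p ^ (k - 1)) \<le> ?rhs"
  proof -
    have "p ^ k * ((real n / real r) ^ (r - 2) * p ^ (k - 1))
        \<le> p ^ k * (real ((n - 2) choose (r - 2)) * p ^ (k - 1))"
      using p01 binomial_diff_2_ge[OF r_ge_3 r_le_n] by (intro mult_left_mono mult_right_mono) auto
    also have "\<dots> = (\<Sum>T\<in>(\<lambda>R. all_edges (e \<union> R)) ` ?I. p ^ (k + (k - 1)))"
    proof -
      have "card (V - e) = n - 2" using fin_e e by (simp add: card_Diff_subset)
      hence "card ?I = (n - 2) choose (r - 2)" using n_subsets[of "V - e" "r - 2"] by simp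
      thus ?thesis by (simp add: card_image[OF inj] power_add)
    qed
    also have "\<dots> \<le> (\<Sum>T\<in>(\<lambda>R. all_edges (e \<union> R)) ` ?I. p ^ card (S \<union> T))"
    proof (intro sum_mono C.power_antimono)
      fix T assume "T \<in> (\<lambda>R. all_edges (e \<union> R)) ` ?I"
      hence T: "T \<in> cliques" "T \<inter> S \<noteq> {}" using sub by (auto simp: C.link_def)
      \<comment> \<open>Sharing the edge saves one factor \<open>p\<close> in the union.\<close>
      have "1 \<le> card (S \<inter> T)"
        using T C.finite_mem_Fam[OF S] by (simp add: Suc_le_eq card_gt_0_iff Int_commute)
      thus "card (S \<union> T) \<le> k + (k - 1)" using C.card_Un_Int_Fam[OF S T(1)] by simp
    qed
    also have "\<dots> \<le> ?rhs"
      using sub p01 C.finite_link by (intro sum_mono2) auto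
    finally show ?thesis .
  qed
  have "p ^ k * M / real r ^ (r - 2)
      = max (p ^ k * (1 / real r ^ (r - 2))) (p ^ k * ((real n / real r) ^ (r - 2) * p ^ (k - 1)))"
    unfolding clique_density_def using p01 r_ge_3
    by (simp add: max_mult_distrib_left max_divide_distrib_right power_divide)
  also have "\<dots> \<le> ?rhs"
  proof (rule max.boundedI)
    have "1 / real r ^ (r - 2) \<le> 1" using r_ge_3 by simp
    hence "p ^ k * (1 / real r ^ (r - 2)) \<le> p ^ k * 1" using p01 by (intro mult_left_mono) auto
    thus "p ^ k * (1 / real r ^ (r - 2)) \<le> ?rhs" using one by simp
  qed (rule two)
  finally show ?thesis .
qed

lemma m2_ge: "real n ^ r * p ^ k * M / real r ^ (2 * r - 2) \<le> C.m2"
proof -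
  have "card cliques = n choose r"
    using n_subsets[of V r] by (simp add: cliques_def card_image[OF inj_cliques'])
  moreover have "(real n / real r) ^ r \<le> real (n choose r)"
    using r_le_n by (intro binomial_ge_n_over_k_pow_k) auto
  ultimately have "(real n / real r) ^ r * (p ^ k * M / real r ^ (r - 2))
      \<le> real (card cliques) * (p ^ k * M / real r ^ (r - 2))"
    using p01 M_ge_1 by (intro mult_right_mono) auto
  also have "\<dots> = (\<Sum>S\<in>cliques. p ^ k * M / real r ^ (r - 2))" by simp
  also have "\<dots> \<le> (\<Sum>S\<in>cliques. \<Sum>T\<in>C.link S. p ^ card (S \<union> T))"
    by (intro sum_mono sum_link_clique_ge)
  also have "\<dots> = C.m2"
    unfolding C.m2_def C.pairs_def
    by (rule sum.Sigma) (use C.finite_Fam C.finite_link in auto)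
  finally show ?thesis
    using r_ge_3 by (simp add: power_divide power_add[symmetric] mult_2)
qed

text \<open>Attaching cliques costs a factor \<open>M\<close>, while \<open>m2\<close> brings
  \<open>M\<close> under the root in the denominator, so a square root of \<open>M\<close>
  survives.\<close>

lemma abs_cdf_diff_clique_le:
  "\<bar>C.expec (\<lambda>A. of_bool (C.std A \<le> z)) - std_normal_cdf z\<bar>
     \<le> 10 * 2 ^ (3 * r) * sqrt (real k * real r ^ (2 * r - 2))
        * sqrt (M / ((1 - p) * (real n ^ r * p ^ k)))"
proof -
  define L where "L = real n ^ r * p ^ k * M / real r ^ (2 * r - 2)"
  have pos: "0 < real n ^ r * p ^ k" "0 < M" "0 < real r ^ (2 * r - 2)" "0 < 1 - p"
    using r_ge_3 r_le_n p01 M_ge_1 by auto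
  have L: "0 < L" "L \<le> C.m2" using pos m2_ge by (auto simp: L_def)
  have "\<bar>C.expec (\<lambda>A. of_bool (C.std A \<le> z)) - std_normal_cdf z\<bar>
      \<le> 10 * (2 ^ (3 * r) * M) * sqrt (real k / ((1 - p) * C.m2))"
    using L pos by (intro C.abs_cdf_diff_le_m2 sum_link_three_le) auto
  also have "\<dots> \<le> 10 * (2 ^ (3 * r) * M) * sqrt (real k / ((1 - p) * L))"
    using L pos by (intro mult_left_mono real_sqrt_le_mono divide_left_mono mult_mono mult_pos_pos) auto
  also have "\<dots> = 10 * 2 ^ (3 * r) * (M * sqrt (real k / ((1 - p) * L)))" by simp
  also have "M * sqrt (real k / ((1 - p) * L)) = sqrt (M\<^sup>2 * (real k / ((1 - p) * L)))"
    unfolding real_sqrt_mult using pos by simp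
  also have "M\<^sup>2 * (real k / ((1 - p) * L))
      = (real k * real r ^ (2 * r - 2)) * (M / ((1 - p) * (real n ^ r * p ^ k)))"
  proof -
    have "m\<^sup>2 * (K / (q * (N * m / R))) = (K * R) * (m / (q * N))"
      if "0 < m" "0 < q" "0 < N" "0 < R" for m K q N R :: real
      using that by (simp add: field_simps power2_eq_square)
    from this[OF pos(2,4,1,3)] show ?thesis unfolding L_def .
  qed
  finally show ?thesis by (simp only: real_sqrt_mult mult.assoc)
qed

end

section \<open>Transfer to the random graph, and the rate in the three ranges of
  \<open>p\<close>\<close>

context clique_count begin

text \<open>A copy of a complete graph carries all edges on its vertices, so copies correspond to
  the r-subsets of \<open>V\<close> whose edges all lie in \<open>A\<close>.\<close>

lemma subgraph_count_eq_cnt: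
  fixes G :: "'v ugraph"
  assumes G: "complete_graph G" "card (verts G) = r"
  shows "real (subgraph_count G (V, A)) = C.cnt A"
proof -
  let ?I = "{s. s \<subseteq> V \<and> card s = r \<and> all_edges s \<subseteq> A}"
  have image_all_edges: "(\<lambda>e. f ` e) ` all_edges s = all_edges (f ` s)" if "inj_on f s"
    for f :: "'a \<Rightarrow> 'b" and s
  proof
    show "(\<lambda>e. f ` e) ` all_edges s \<subseteq> all_edges (f ` s)"
      using that by (auto simp: all_edges_def card_image inj_on_subset)
    show "all_edges (f ` s) \<subseteq> (\<lambda>e. f ` e) ` all_edges s"
    proof
      fix e assume "e \<in> all_edges (f ` s)"
      then obtain e' where "e' \<subseteq> s" "e = f ` e'" "card e = 2"
        by (auto simp: all_edges_def subset_image_iff)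
      thus "e \<in> (\<lambda>e. f ` e) ` all_edges s"
        using that by (auto simp: all_edges_def card_image inj_on_subset)
    qed
  qed
  have finG: "finite (verts G)" "edges G = all_edges (verts G)"
    using G by (auto simp: complete_graph_def)
  have "{S. subgraph S (V, A) \<and> graph_iso S G} = (\<lambda>s. (s, all_edges s)) ` ?I"
  proof (intro equalityI subsetI)
    fix S assume "S \<in> {S. subgraph S (V, A) \<and> graph_iso S G}"
    hence sub: "edges S \<subseteq> all_edges (verts S)" "verts S \<subseteq> V" "edges S \<subseteq> A" and "graph_iso S G"
      by (auto simp: subgraph_def simple_graph_def)
    then obtain f where f: "bij_betw f (verts S) (verts G)" "(\<lambda>e. f ` e) ` edges S = edges G"
      by (auto simp: graph_iso_def)
    have inj: "inj_on f (verts S)" and img: "f ` verts S = verts G"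
      using f(1) by (auto simp: bij_betw_def)
    have "edges S = all_edges (verts S)"
    proof (rule inj_on_image_eq_iff[THEN iffD1])
      show "inj_on (\<lambda>e. f ` e) (Pow (verts S))"
        using inj by (rule inj_on_image_Pow)
      show "(\<lambda>e. f ` e) ` edges S = (\<lambda>e. f ` e) ` all_edges (verts S)"
        using image_all_edges[OF inj] img f(2) finG by simp
    qed (use sub(1) in \<open>auto simp: all_edges_def\<close>)
    moreover have "card (verts S) = r"
      using bij_betw_same_card[OF f(1)] G by simp
    ultimately show "S \<in> (\<lambda>s. (s, all_edges s)) ` ?I"
      using sub by (intro image_eqI[of _ _ "verts S"]) (auto simp: prod_eq_iff)
  next
    fix S assume "S \<in> (\<lambda>s. (s, all_edges s)) ` ?I"
    then obtain s where s: "S = (s, all_edges s)" "s \<subseteq> V" "card s = r" "all_edges s \<subseteq> A" by auto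
    have "finite s" using s finite_sub_V by blast
    then obtain f where f: "bij_betw f s (verts G)"
      using finite_same_card_bij[of s "verts G"] finG G s by auto
    hence "(\<lambda>e. f ` e) ` all_edges s = edges G"
      using image_all_edges[of f s] finG by (simp add: bij_betw_def)
    thus "S \<in> {S. subgraph S (V, A) \<and> graph_iso S G}"
      using s f \<open>finite s\<close> by (auto simp: subgraph_def simple_graph_def graph_iso_def)
  qed
  hence "subgraph_count G (V, A) = card ?I"
    unfolding subgraph_count_def by (simp add: card_image inj_on_def)
  also have "real (card ?I) = (\<Sum>s\<in>{s. s \<subseteq> V \<and> card s = r}. of_bool (all_edges s \<subseteq> A))"
    by (simp add: sum_of_bool_eq Int_def conj_assoc)
  also have "\<dots> = C.cnt A"
    unfolding C.cnt_def by (rule sum.reindex_cong[OF inj_cliques' cliques_def, symmetric]) simp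
  finally show ?thesis .
qed

lemma expectation_erdos_renyi:
  "measure_pmf.expectation (erdos_renyi n p) f = C.expec (\<lambda>A. f (V, A))"
proof -
  let ?E = "all_edges V"
  let ?P = "Pi_pmf ?E False (\<lambda>_. bernoulli_pmf p)"
  have fin: "finite ?E" by (simp add: finite_all_edges)
  have inj: "inj_on (\<lambda>A e. e \<in> A) (Pow ?E)"
    by (rule inj_onI) (auto dest: fun_cong)
  have "measure_pmf.expectation (erdos_renyi n p) f
      = (\<Sum>\<omega>\<in>(\<lambda>A e. e \<in> A) ` Pow ?E. f (V, {e \<in> ?E. \<omega> e}) * pmf ?P \<omega>)"
    unfolding erdos_renyi_def integral_map_pmf
  proof (rule integral_measure_pmf_real)
    \<comment> \<open>The default value \<open>False\<close> of the product distribution makes each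
      configuration the membership predicate of a set of edges.\<close>
    fix \<omega> assume "\<omega> \<in> set_pmf ?P"
    hence "\<omega> e \<Longrightarrow> e \<in> ?E" for e
      using set_Pi_pmf_subset[OF fin] by fastforce
    thus "\<omega> \<in> (\<lambda>A e. e \<in> A) ` Pow ?E"
      by (intro image_eqI[of _ _ "{e. \<omega> e}"]) auto
  qed (use fin in auto)
  also have "\<dots> = (\<Sum>A\<in>Pow ?E. f (V, {e \<in> ?E. e \<in> A}) * pmf ?P (\<lambda>e. e \<in> A))"
    by (subst sum.reindex[OF inj]) simp
  also have "\<dots> = (\<Sum>A\<in>Pow ?E. C.weight A * f (V, A))"
  proof (rule sum.cong[OF refl])
    fix A assume A: "A \<in> Pow ?E"
    have "pmf ?P (\<lambda>e. e \<in> A) = (\<Prod>e\<in>?E. if e \<in> A then p else 1 - p)"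
      using A p01 fin by (subst pmf_Pi') (auto intro!: prod.cong)
    also have "\<dots> = C.weight A"
      using fin A by (simp add: prod.If_cases C.weight_def Int_absorb1 Diff_eq)
    finally show "f (V, {e \<in> ?E. e \<in> A}) * pmf ?P (\<lambda>e. e \<in> A) = C.weight A * f (V, A)"
      using A by (simp add: Collect_conj_eq Int_absorb1 mult.commute)
  qed
  finally show ?thesis by (simp add: C.expec_def)
qed

lemma normalized_subgraph_count_eq_std:
  fixes G :: "'v ugraph"
  assumes G: "complete_graph G" "card (verts G) = r"
  shows "normalized_subgraph_count G n p (V, A) = C.std A"
  unfolding normalized_subgraph_count_def standardize_def expectation_erdos_renyi
    subgraph_count_eq_cnt[OF G] C.std_def C.vari_def ..

lemma kolmogorov_dist_le:
  fixes G :: "'v ugraph"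
  assumes G: "complete_graph G" "card (verts G) = r"
  shows "kolmogorov_dist
      (distr (measure_pmf (erdos_renyi n p)) borel (normalized_subgraph_count G n p))
      std_normal_distribution
    \<le> 10 * 2 ^ (3 * r) * sqrt (real k * real r ^ (2 * r - 2))
        * sqrt (M / ((1 - p) * (real n ^ r * p ^ k)))"
  unfolding kolmogorov_dist_def
proof (rule cSUP_least)
  fix z :: real
  let ?X = "normalized_subgraph_count G n p" and ?P = "erdos_renyi n p"
  have "cdf (distr (measure_pmf ?P) borel ?X) z = measure (measure_pmf ?P) {H. ?X H \<le> z}"
    unfolding cdf_def by (subst measure_distr) (auto simp: vimage_def)
  also have "\<dots> = measure_pmf.expectation ?P (indicator {H. ?X H \<le> z})"
    by simp
  also have "\<dots> = C.expec (\<lambda>A. of_bool (C.std A \<le> z))"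
    unfolding expectation_erdos_renyi
    by (simp add: indicator_def normalized_subgraph_count_eq_std[OF G])
  finally show "\<bar>cdf (distr (measure_pmf ?P) borel ?X) z - std_normal_cdf z\<bar>
      \<le> 10 * 2 ^ (3 * r) * sqrt (real k * real r ^ (2 * r - 2))
        * sqrt (M / ((1 - p) * (real n ^ r * p ^ k)))"
    using abs_cdf_diff_clique_le[of z] by simp
qed simp

lemma edge_term_ratio:
  "real n ^ (r - 2) * p ^ (k - 1) / (real n ^ r * p ^ k) = 1 / (real n ^ 2 * p)"
proof -
  have k: "k = (k - 1) + 1" using r_ge_3 by (simp add: Suc_le_eq)
  have r: "r = (r - 2) + 2" using r_ge_3 by simp
  have "real n ^ (r - 2) * p ^ (k - 1) / (real n ^ r * p ^ k)
      = real n ^ (r - 2) * p ^ (k - 1) / (real n ^ (r - 2) * real n ^ 2 * (p ^ (k - 1) * p ^ 1))"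
    by (metis k r power_add)
  also have "\<dots> = 1 / (real n ^ 2 * p)"
    using p01 r_ge_3 r_le_n by simp
  finally show ?thesis .
qed

lemma real_two_k: "2 * real k = real r * (real r - 1)"
proof -
  have "even (r * (r - 1))" by (cases "even r") auto
  hence "2 * k = r * (r - 1)" unfolding choose_two by (rule dvd_mult_div_cancel)
  hence "2 * real k = real (r * (r - 1))" by (metis of_nat_mult of_nat_numeral)
  thus ?thesis using r_ge_3 by (simp add: of_nat_diff)
qed

text \<open>With \<open>t = n p^((r+1)/2)\<close>, the second entry of the maximum in \<open>clique_density\<close> is
  \<open>t^(r-2)\<close>; the threshold on \<open>p\<close> is \<open>t = 1\<close>.\<close>

lemma edge_term_eq_powr:
  "real n ^ (r - 2) * p ^ (k - 1) = (real n * p powr ((real r + 1) / 2)) ^ (r - 2)"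
proof -
  have "2 * (real k - 1) = (real r + 1) * real (r - 2)"
    using real_two_k r_ge_3 by (simp add: of_nat_diff algebra_simps)
  hence e: "real (k - 1) = (real r + 1) / 2 * real (r - 2)"
    using r_ge_3 by (simp add: of_nat_diff Suc_le_eq)
  have "p ^ (k - 1) = p powr ((real r + 1) / 2 * real (r - 2))"
    unfolding e[symmetric] using p01 by (simp add: powr_realpow)
  also have "\<dots> = (p powr ((real r + 1) / 2)) ^ (r - 2)"
    unfolding powr_powr[symmetric] using p01 by (intro powr_realpow) simp
  finally show ?thesis by (simp add: power_mult_distrib)
qed

lemma threshold_powr:
  "real n * (real n powr (- 2 / (real r + 1))) powr ((real r + 1) / 2) = 1"
proof -
  have "- 2 / (real r + 1) * ((real r + 1) / 2) = - 1" by (simp add: field_simps)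
  thus ?thesis using r_ge_3 r_le_n by (simp only: powr_powr) (simp add: powr_minus_divide)
qed

lemma clique_density_above:
  assumes "real n powr (- 2 / (real r + 1)) < p"
  shows "M = real n ^ (r - 2) * p ^ (k - 1)"
proof -
  have "(real n powr (- 2 / (real r + 1))) powr ((real r + 1) / 2) \<le> p powr ((real r + 1) / 2)"
    using assms by (intro powr_mono2) auto
  from mult_left_mono[OF this, of "real n"] have "1 \<le> real n * p powr ((real r + 1) / 2)"
    unfolding threshold_powr by simp
  thus ?thesis unfolding clique_density_def edge_term_eq_powr
    by (intro max_absorb2 one_le_power)
qed

lemma clique_density_below:
  assumes "p \<le> real n powr (- 2 / (real r + 1))"
  shows "M = 1"
proof -
  have "p powr ((real r + 1) / 2) \<le> (real n powr (- 2 / (real r + 1))) powr ((real r + 1) / 2)"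
    using assms p01 by (intro powr_mono2) auto
  from mult_left_mono[OF this, of "real n"] have "real n * p powr ((real r + 1) / 2) \<le> 1"
    unfolding threshold_powr by simp
  thus ?thesis unfolding clique_density_def edge_term_eq_powr
    by (intro max_absorb1 power_le_one) auto
qed

abbreviation rate :: real where
  "rate \<equiv> sqrt (M / ((1 - p) * (real n ^ r * p ^ k)))"

lemma rate_eq: "rate = sqrt (M / (real n ^ r * p ^ k)) / sqrt (1 - p)"
  by (simp add: real_sqrt_divide[symmetric] mult.commute)

text \<open>Both entries of the maximum, divided by \<open>real n ^ r * p ^ k\<close>, are at most
  \<open>1 / (real n ^ 2 * c ^ k)\<close>, because \<open>r\<close> exceeds 2 and \<open>p\<close>
  exceeds \<open>c\<close>.\<close>

lemma rate_le_dense: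
  assumes c: "0 < c" "c < p"
  shows "rate \<le> 1 / sqrt (c ^ k) * (1 / (real n * sqrt (1 - p)))"
proof -
  have n: "real n > 0" using r_ge_3 r_le_n by simp
  have "M / (real n ^ r * p ^ k) = max (1 / (real n ^ r * p ^ k)) (1 / (real n ^ 2 * p))"
    unfolding clique_density_def edge_term_ratio[symmetric] using p01
    by (simp add: max_divide_distrib_right)
  also have "\<dots> \<le> 1 / (real n ^ 2 * c ^ k)"
  proof (rule max.boundedI)
    show "1 / (real n ^ r * p ^ k) \<le> 1 / (real n ^ 2 * c ^ k)"
      using c n r_ge_3 r_le_n p01
      by (intro divide_left_mono mult_mono power_increasing power_mono) auto
    have "c ^ k \<le> c ^ 1" using c p01 r_ge_3 by (intro power_decreasing) (auto simp: Suc_le_eq)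
    hence "c ^ k \<le> p" using c by simp
    thus "1 / (real n ^ 2 * p) \<le> 1 / (real n ^ 2 * c ^ k)"
      using c n p01 by (intro divide_left_mono mult_left_mono) auto
  qed
  finally have "sqrt (M / (real n ^ r * p ^ k)) \<le> sqrt (1 / (real n ^ 2 * c ^ k))"
    by (rule real_sqrt_le_mono)
  also have "\<dots> = 1 / (real n * sqrt (c ^ k))"
    using n by (simp add: real_sqrt_divide real_sqrt_mult)
  finally have "rate \<le> 1 / (real n * sqrt (c ^ k)) / sqrt (1 - p)"
    unfolding rate_eq using p01 by (intro divide_right_mono) auto
  thus ?thesis by (simp add: mult_ac)
qed

lemma rate_le_middle:
  assumes "real n powr (- 2 / (real r + 1)) < p" "p \<le> c" "c < 1"
  shows "rate \<le> 1 / sqrt (1 - c) * (1 / (real n * sqrt p))"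
proof -
  have "rate = 1 / (real n * sqrt p) / sqrt (1 - p)"
    unfolding rate_eq unfolding clique_density_above[OF assms(1)] edge_term_ratio
    by (simp add: real_sqrt_divide real_sqrt_mult)
  also have "\<dots> \<le> 1 / (real n * sqrt p) / sqrt (1 - c)"
    using assms p01 by (intro divide_left_mono) auto
  finally show ?thesis by (simp add: mult_ac)
qed

text \<open>Here \<open>M = 1\<close>. As \<open>n\<close> is at least 2, the threshold is at most
  \<open>?\<delta> < 1\<close>, which keeps \<open>1 - p\<close> away from zero.\<close>

lemma rate_le_sparse:
  assumes "p \<le> real n powr (- 2 / (real r + 1))"
  shows "rate \<le> 1 / sqrt (1 - 2 powr (- 2 / (real r + 1)))
    * (1 / (real n powr (real r / 2) * p powr (real r * (real r - 1) / 4)))"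
proof -
  let ?\<delta> = "2 powr (- 2 / (real r + 1))"
  have n: "real n > 0" using r_ge_3 r_le_n by simp
  have "real n powr (- 2 / (real r + 1)) \<le> ?\<delta>"
    using r_ge_3 r_le_n by (intro powr_mono2') auto
  hence "p \<le> ?\<delta>" using assms by simp
  have "?\<delta> < 2 powr 0" by (intro powr_less_mono) (auto simp: field_simps)
  hence \<delta>: "?\<delta> < 1" by simp
  have k2: "real k / 2 = real r * (real r - 1) / 4"
    using real_two_k by simp
  have "sqrt (M / (real n ^ r * p ^ k)) = 1 / (sqrt (real n ^ r) * sqrt (p ^ k))"
    unfolding clique_density_below[OF assms] by (simp add: real_sqrt_divide real_sqrt_mult)
  also have "sqrt (real n ^ r) = real n powr (real r / 2)"
    using n by (simp add: powr_half_sqrt[symmetric] powr_realpow[symmetric] powr_powr)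
  also have "sqrt (p ^ k) = p powr (real r * (real r - 1) / 4)"
    unfolding k2[symmetric]
    using p01 by (simp add: powr_half_sqrt[symmetric] powr_realpow[symmetric] powr_powr)
  finally have "rate = 1 / (real n powr (real r / 2) * p powr (real r * (real r - 1) / 4)) / sqrt (1 - p)"
    unfolding rate_eq by simp
  also have "\<dots> \<le> 1 / (real n powr (real r / 2) * p powr (real r * (real r - 1) / 4)) / sqrt (1 - ?\<delta>)"
    using \<open>p \<le> ?\<delta>\<close> \<delta> p01 by (intro divide_left_mono) auto
  finally show ?thesis by (simp add: mult_ac)
qed

end

theorem corollary4p5:
  fixes G :: "'v ugraph" and r :: nat and c :: real
  assumes "complete_graph G" and "card (verts G) = r" and "r \<ge> 3"
    and "0 < c" and "c < 1"
  shows "\<exists>C>0. \<forall>p :: nat \<Rightarrow> real. (\<forall>n. 0 < p n \<and> p n < 1) \<longrightarrow>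
    (\<forall>n\<ge>r.
      (let d = kolmogorov_dist
             (distr (measure_pmf (erdos_renyi n (p n))) borel (normalized_subgraph_count G n (p n)))
             std_normal_distribution
       in (c < p n \<and> p n < 1 \<longrightarrow> d \<le> C * (1 / (real n * sqrt (1 - p n)))) \<and>
          (real n powr (- 2 / (real r + 1)) < p n \<and> p n \<le> c \<longrightarrow>
             d \<le> C * (1 / (real n * sqrt (p n)))) \<and>
          (0 < p n \<and> p n \<le> real n powr (- 2 / (real r + 1)) \<longrightarrow>
             d \<le> C * (1 / (real n powr (real r / 2) * p n powr (real r * (real r - 1) / 4))))))"
proof -
  let ?k = "r choose 2" and ?\<delta> = "2 powr (- 2 / (real r + 1)) :: real"
  define K where "K = 10 * 2 ^ (3 * r) * sqrt (real ?k * real r ^ (2 * r - 2))"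
  \<comment> \<open>The losses in the dense, middle and sparse range. They depend only on
    \<open>r\<close> and \<open>c\<close>, and their sum serves all three ranges at once.\<close>
  define C1 C2 C3 where "C1 = 1 / sqrt (c ^ ?k)" and "C2 = 1 / sqrt (1 - c)"
    and "C3 = 1 / sqrt (1 - ?\<delta>)"
  have "?\<delta> < 2 powr 0" by (intro powr_less_mono) (auto simp: field_simps)
  hence C: "0 < C1" "0 < C2" "0 < C3"
    using assms(4,5) by (simp_all add: C1_def C2_def C3_def)
  have K: "0 < K" using assms(3) by (simp add: K_def)
  have le: "d \<le> K * (C1 + C2 + C3) * x" if "d \<le> K * y" "y \<le> C' * x" "C' \<le> C1 + C2 + C3" "0 \<le> x"
    for d x y C'
  proof -
    have "d \<le> K * (C' * x)" using that(1,2) K by (meson mult_left_mono less_imp_le order.trans)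
    also have "\<dots> \<le> K * ((C1 + C2 + C3) * x)" using that K by (intro mult_left_mono mult_right_mono) auto
    finally show ?thesis by (simp add: mult.assoc)
  qed
  show ?thesis
  proof (intro exI[of _ "K * (C1 + C2 + C3)"] conjI allI impI)
    show "0 < K * (C1 + C2 + C3)" using K C by simp
    fix p :: "nat \<Rightarrow> real" and n
    assume p: "\<forall>n. 0 < p n \<and> p n < 1" and n: "r \<le> n"
    interpret clique_count n r "p n"
      by unfold_locales (use assms(3) n p in auto)
    note d = kolmogorov_dist_le[OF assms(1,2), folded K_def]
    let ?d = "kolmogorov_dist
             (distr (measure_pmf (erdos_renyi n (p n))) borel (normalized_subgraph_count G n (p n)))
             std_normal_distribution"
    show "let d = kolmogorov_dist
             (distr (measure_pmf (erdos_renyi n (p n))) borel (normalized_subgraph_count G n (p n)))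
             std_normal_distribution
       in (c < p n \<and> p n < 1 \<longrightarrow> d \<le> K * (C1 + C2 + C3) * (1 / (real n * sqrt (1 - p n)))) \<and>
          (real n powr (- 2 / (real r + 1)) < p n \<and> p n \<le> c \<longrightarrow>
             d \<le> K * (C1 + C2 + C3) * (1 / (real n * sqrt (p n)))) \<and>
          (0 < p n \<and> p n \<le> real n powr (- 2 / (real r + 1)) \<longrightarrow>
             d \<le> K * (C1 + C2 + C3) * (1 / (real n powr (real r / 2) * p n powr (real r * (real r - 1) / 4))))"
      unfolding Let_def
    proof (intro conjI impI; (elim conjE)?)
      assume "c < p n"
      thus "?d \<le> K * (C1 + C2 + C3) * (1 / (real n * sqrt (1 - p n)))"
        using C assms(4) p01 by (intro le[OF d rate_le_dense[of c, folded C1_def]]) auto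
    next
      assume "real n powr (- 2 / (real r + 1)) < p n" "p n \<le> c"
      thus "?d \<le> K * (C1 + C2 + C3) * (1 / (real n * sqrt (p n)))"
        using C assms(5) p01 by (intro le[OF d rate_le_middle[of c, folded C2_def]]) auto
    next
      assume "p n \<le> real n powr (- 2 / (real r + 1))"
      thus "?d \<le> K * (C1 + C2 + C3) * (1 / (real n powr (real r / 2) * p n powr (real r * (real r - 1) / 4)))"
        using C by (intro le[OF d rate_le_sparse[folded C3_def]]) auto
    qed
  qed
qed

end
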